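(* Let $\Omega\subset\mathbb{R}^D$ and suppose that for $\mathcal{H}^d$-almost every $x\in\Omega$ there is $h_0>0$ such that $B(x,h_0)\cap\Omega$ is a smooth embedded $d$-dimensional submanifold of $\mathbb{R}^D$. Let $P$ be a probability measure on $\Omega$ with density $p$ with respect to $\mathcal{H}^d$, where $p$ is twice continuously differentiable (i.e. near each such $x$ it is the restriction of a $C^2$ function on a neighbourhood of $x$ in $\mathbb{R}^D$). Let $X_1,X_2,\ldots$ be i.i.d. with law $P$. Let $K:[0,\infty)\to\mathbb{R}$ vanish outside $[0,1]$, satisfy $\int_{\mathbb{R}^d}K(\|u\|)\,du=1$, and be such that $u\mapsto K(\|u\|)$ is twice continuously differentiable on $\mathbb{R}^D$. If $h_n=c\,n^{-1/(d+4)}$ for a constant $c>0$, then for $\mathcal{H}^d$-almost every $x\in\Omega$, $$\mathrm{MSE}(\hat p_n(x))=\mathbb{E}\big[(\hat p_n(x)-p(x))^2\big]=O\!\left(n^{-4/(d+4)}\right)\quad(n\to\infty).$$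
   Context: $\mathcal{H}^d$ denotes $d$-dimensional Hausdorff measure on $\mathbb{R}^D$; $B(x,r)$ is the open Euclidean ball. Given i.i.d. samples $X_1,\dots,X_n\sim P$, a kernel $K$ and bandwidth $h_n>0$, the estimator is $\hat p_n(x)=\frac{1}{n h_n^d}\sum_{i=1}^n K\!\left(\frac{\|X_i-x\|}{h_n}\right)$. *)

theory Defs
  imports "HOL-Probability.Probability" "HOL-Library.Landau_Symbols"
begin

definition hausdorff_outer :: "nat \<Rightarrow> 'a::metric_space set \<Rightarrow> ennreal" where
  "hausdorff_outer d A =
     (SUP \<delta>\<in>{0::real<..}.
        INF C \<in> {C :: nat \<Rightarrow> 'a set. A \<subseteq> (\<Union>i. C i) \<and>
                     (\<forall>i. bounded (C i) \<and> diameter (C i) \<le> \<delta>)}.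
          (\<Sum>i. ennreal (unit_ball_vol (real d) * (diameter (C i) / 2) ^ d)))"

definition hausdorff_measure :: "nat \<Rightarrow> 'a::metric_space measure" where
  "hausdorff_measure d = measure_of UNIV (sets borel) (hausdorff_outer d)"

definition partial_dir :: "('a::real_normed_vector \<Rightarrow> 'b::real_normed_vector) \<Rightarrow> 'a \<Rightarrow> 'a \<Rightarrow> 'b" where
  "partial_dir g v x = vector_derivative (\<lambda>t. g (x + t *\<^sub>R v)) (at 0)"

fun iter_partial :: "'a list \<Rightarrow> ('a::real_normed_vector \<Rightarrow> 'b::real_normed_vector) \<Rightarrow> 'a \<Rightarrow> 'b" where
  "iter_partial [] g = g"
| "iter_partial (v # vs) g = partial_dir (iter_partial vs g) v"

definition Ck_on :: "nat \<Rightarrow> ('a::euclidean_space \<Rightarrow> 'b::real_normed_vector) \<Rightarrow> 'a set \<Rightarrow> bool" where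
  "Ck_on k f S \<longleftrightarrow> open S \<and>
     (\<forall>vs. set vs \<subseteq> Basis \<and> length vs \<le> k \<longrightarrow>
        continuous_on S (iter_partial vs f) \<and>
        (length vs < k \<longrightarrow> (\<forall>v\<in>Basis. \<forall>x\<in>S.
            (\<lambda>t. iter_partial vs f (x + t *\<^sub>R v)) differentiable (at 0))))"

definition smooth_on :: "('a::euclidean_space \<Rightarrow> 'b::real_normed_vector) \<Rightarrow> 'a set \<Rightarrow> bool" where
  "smooth_on f S \<longleftrightarrow> (\<forall>k. Ck_on k f S)"

definition smooth_submanifold :: "'b::euclidean_space itself \<Rightarrow> 'a::euclidean_space set \<Rightarrow> bool" where
  "smooth_submanifold _ M \<longleftrightarrow>
     (\<forall>y\<in>M. \<exists>U V (\<phi>::'b \<Rightarrow> 'a) \<phi>'. open U \<and> y \<in> U \<and> open V \<and>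
        smooth_on \<phi> V \<and> homeomorphism V (M \<inter> U) \<phi> (inv_into V \<phi>) \<and>
        (\<forall>v\<in>V. (\<phi> has_derivative \<phi>' v) (at v) \<and> inj (\<phi>' v)))"

end

theory Submission
  imports Defs
begin

text \<open>
  Near a regular point \<open>x\<close> the set \<open>\<Omega>\<close> is a graph \<open>w \<mapsto> s w\<close> over its tangent space with
  \<open>s w = x + \<iota> w + O(\<bar>w\<bar>\<^sup>2)\<close>, the error being almost normal. Hence \<open>s\<close> distorts distances on the ball of
  radius \<open>r\<close> by a factor between \<open>1\<close> and \<open>1 + C r\<^sup>2\<close>, and the Hausdorff measure, pulled back along \<open>s\<close>,
  lies between Lebesgue measure and \<open>(1 + C r\<^sup>2)\<^sup>d\<close> times Lebesgue measure. The lower bound is the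
  isodiametric inequality (from Prekopa--Leindler applied to \<open>C\<close>, \<open>-C\<close> and \<open>(C - C)/2\<close>), the upper bound
  is the Vitali covering theorem. With \<open>r = h\<close> the expectation of the kernel becomes a Euclidean integral up to
  \<open>O(h\<^sup>2)\<close>, in which the linear Taylor term of the density is odd and integrates to zero: the bias is
  \<open>O(h\<^sup>2)\<close>. The variance is \<open>O(1/(n h\<^sup>d))\<close>, and the chosen bandwidth balances \<open>h\<^sup>4\<close> against it.
\<close>

section \<open>Strict differentiability of C2 maps\<close>

text \<open>The rate leaves no slack at first order: a relative error of order \<open>h\<close>
  would put \<open>h^2\<close> into the squared bias, where \<open>h^4\<close> is needed. An
  arbitrary chart distorts volume at order \<open>h\<close>. Over the tangent space the tangential
  part of an increment is recovered exactly by projection; only the normal part, of relative size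
  \<open>O(h)\<close>, is lost, and by Pythagoras it enters lengths squared. The linear Taylor term
  of the density is itself of order \<open>h\<close> and cannot be estimated away. It has to cancel,
  which it does only after \<open>s\<close>, the kernel argument and the measure have been replaced
  by their flat counterparts, each at a cost of \<open>O(h^2)\<close>.

  The comparison of measures needs constants tending to 1, since a fixed factor would change the
  limit of the estimator. Covers in \<open>hausdorff_outer\<close> consist of arbitrary sets, so the
  lower bound needs the sharp bound of volume by diameter, and the upper bound needs covers by balls
  whose total volume exceeds that of the set by arbitrarily little. The normalisation by
  \<open>unit_ball_vol\<close> makes the two constants meet.\<close>

lemma partials_increment_bound:
  fixes f :: "'a::euclidean_space \<Rightarrow> 'b::real_normed_vector" and e :: real
  assumes der: "\<And>y b. y \<in> cbox l u \<Longrightarrow> b \<in> Basis \<Longrightarrow>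
      ((\<lambda>t. f (y + t *\<^sub>R b)) has_vector_derivative D b y) (at 0)"
    and bnd: "\<And>y b. y \<in> cbox l u \<Longrightarrow> b \<in> Basis \<Longrightarrow> norm (D b y - L b) \<le> e"
    and y: "y \<in> cbox l u" and z: "z \<in> cbox l u"
  shows "norm (f y - f z - (\<Sum>b\<in>Basis. ((y - z) \<bullet> b) *\<^sub>R L b)) \<le> DIM('a) * e * norm (y - z)"
proof -
  \<comment> \<open>\<open>w B\<close> is a corner of a staircase from \<open>z\<close> to
    \<open>y\<close>: the coordinates in \<open>B\<close> are already those of \<open>y\<close>.
    Only derivatives along the axes are given, so every leg must be parallel to an axis; a box,
    unlike a ball in general, contains all these corners.\<close>
  define w where "w B = (\<Sum>b\<in>Basis. (if b \<in> B then y \<bullet> b else z \<bullet> b) *\<^sub>R b)" for B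
  have w_inner: "w B \<bullet> b = (if b \<in> B then y \<bullet> b else z \<bullet> b)" if "b \<in> Basis" for B b
    using that by (simp add: w_def)
  have main: "norm (f (w B) - f z - (\<Sum>b\<in>B. ((y - z) \<bullet> b) *\<^sub>R L b)) \<le> card B * e * norm (y - z)"
    if "finite B" "B \<subseteq> Basis" for B
    using that
  proof (induction B rule: finite_induct)
    case empty
    have "w {} = z" by (simp add: w_def euclidean_representation)
    then show ?case by simp
  next
    case (insert b B)
    then have b: "b \<in> Basis" and IH: "norm (f (w B) - f z - (\<Sum>b\<in>B. ((y - z) \<bullet> b) *\<^sub>R L b)) \<le> card B * e * norm (y - z)"
      by auto
    define \<delta> where "\<delta> = (y - z) \<bullet> b"
    have step: "w (insert b B) = w B + \<delta> *\<^sub>R b"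
    proof (rule euclidean_eqI)
      fix i :: 'a assume i: "i \<in> Basis"
      show "w (insert b B) \<bullet> i = (w B + \<delta> *\<^sub>R b) \<bullet> i"
        using insert.hyps(2) b i
        by (cases "i = b") (auto simp: w_inner inner_add_left inner_Basis \<delta>_def inner_diff_left)
    qed
    define S where "S = closed_segment 0 \<delta>"
    have mem: "w B + t *\<^sub>R b \<in> cbox l u" if "t \<in> S" for t
    proof (unfold mem_box, intro ballI)
      fix i :: 'a assume i: "i \<in> Basis"
      have yi: "l \<bullet> i \<le> y \<bullet> i" "y \<bullet> i \<le> u \<bullet> i" and zi: "l \<bullet> i \<le> z \<bullet> i" "z \<bullet> i \<le> u \<bullet> i"
        using y z i by (auto simp: mem_box)
      show "l \<bullet> i \<le> (w B + t *\<^sub>R b) \<bullet> i \<and> (w B + t *\<^sub>R b) \<bullet> i \<le> u \<bullet> i"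
      proof (cases "i = b")
        case True
        have "(0 \<le> t \<and> t \<le> \<delta>) \<or> (\<delta> \<le> t \<and> t \<le> 0)"
          using that by (auto simp: S_def closed_segment_eq_real_ivl split: if_splits)
        then show ?thesis
          using True b insert.hyps yi zi by (auto simp: inner_add_left w_inner \<delta>_def inner_diff_left)
      next
        case False
        then show ?thesis
          using yi zi i b by (auto simp: inner_add_left w_inner inner_Basis)
      qed
    qed
    \<comment> \<open>Subtracting the expected linear growth leaves a function with derivative at
      most \<open>e\<close>, so the mean value inequality bounds this leg.\<close>
    define g where "g t = f (w B + t *\<^sub>R b) - t *\<^sub>R L b" for t :: real
    have gder: "(g has_vector_derivative (D b (w B + t *\<^sub>R b) - L b)) (at t)" if "t \<in> S" for t
    proof -
      have "((\<lambda>s. f ((w B + t *\<^sub>R b) + s *\<^sub>R b)) has_vector_derivative D b (w B + t *\<^sub>R b)) (at (t - t))"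
        using der[OF mem[OF that] b] by simp
      then have "((\<lambda>s. f ((w B + t *\<^sub>R b) + (s - t) *\<^sub>R b)) has_vector_derivative 1 *\<^sub>R D b (w B + t *\<^sub>R b)) (at t)"
        by (rule vector_diff_chain_at[unfolded o_def, rotated]) (auto intro!: derivative_eq_intros)
      then have "((\<lambda>s. f (w B + s *\<^sub>R b)) has_vector_derivative D b (w B + t *\<^sub>R b)) (at t)"
        by (simp add: algebra_simps)
      then show ?thesis
        unfolding g_def by (auto intro!: derivative_eq_intros)
    qed
    have "norm (g \<delta> - g 0) \<le> e * norm (\<delta> - 0)"
    proof (rule differentiable_bound[of S])
      show "convex S" by (simp add: S_def)
      fix t assume t: "t \<in> S"
      show "(g has_derivative (\<lambda>h. h *\<^sub>R (D b (w B + t *\<^sub>R b) - L b))) (at t within S)"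
        using gder[OF t] by (simp add: has_vector_derivative_def has_derivative_at_withinI)
      show "onorm (\<lambda>h. h *\<^sub>R (D b (w B + t *\<^sub>R b) - L b)) \<le> e"
        using bnd[OF mem[OF t] b] by (intro onorm_le) (simp add: mult.commute[of e] mult_left_mono)
    qed (auto simp: S_def)
    also have "\<dots> \<le> e * norm (y - z)"
    proof (rule mult_left_mono)
      show "norm (\<delta> - 0) \<le> norm (y - z)" using b by (simp add: \<delta>_def Basis_le_norm)
      show "0 \<le> e" using bnd[OF y b] norm_ge_zero order_trans by blast
    qed
    finally have 1: "norm (f (w (insert b B)) - f (w B) - \<delta> *\<^sub>R L b) \<le> e * norm (y - z)"
      by (simp add: g_def step algebra_simps)
    have "f (w (insert b B)) - f z - (\<Sum>b\<in>insert b B. ((y - z) \<bullet> b) *\<^sub>R L b) =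
      (f (w (insert b B)) - f (w B) - \<delta> *\<^sub>R L b) + (f (w B) - f z - (\<Sum>b\<in>B. ((y - z) \<bullet> b) *\<^sub>R L b))"
      using insert.hyps by (simp add: \<delta>_def)
    also have "norm \<dots> \<le> e * norm (y - z) + card B * e * norm (y - z)"
      using norm_triangle_mono[OF 1 IH] .
    finally show ?case using insert.hyps by (simp add: algebra_simps)
  qed
  have "w Basis = y" by (simp add: w_def euclidean_representation)
  with main[of Basis] show ?thesis by simp
qed

lemma Ck_on_partials:
  assumes "Ck_on 2 f S" "b \<in> Basis" "y \<in> S"
  shows "((\<lambda>t. f (y + t *\<^sub>R b)) has_vector_derivative partial_dir f b y) (at 0)"
    and "c \<in> Basis \<Longrightarrow> ((\<lambda>t. partial_dir f b (y + t *\<^sub>R c)) has_vector_derivative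
          partial_dir (partial_dir f b) c y) (at 0)"
proof -
  have *: "(\<lambda>t. iter_partial vs f (y + t *\<^sub>R v)) differentiable (at 0)"
    if "set vs \<subseteq> Basis" "length vs < 2" "v \<in> Basis" for vs v
    using assms that unfolding Ck_on_def by auto
  show "((\<lambda>t. f (y + t *\<^sub>R b)) has_vector_derivative partial_dir f b y) (at 0)"
    using *[of "[]" b] assms by (simp add: partial_dir_def vector_derivative_works)
  show "c \<in> Basis \<Longrightarrow> ((\<lambda>t. partial_dir f b (y + t *\<^sub>R c)) has_vector_derivative
          partial_dir (partial_dir f b) c y) (at 0)"
    using *[of "[b]" c] assms by (simp add: partial_dir_def vector_derivative_works)
qed

lemma Ck_on_imp_continuous_on_partial:
  "Ck_on k f S \<Longrightarrow> set vs \<subseteq> Basis \<Longrightarrow> length vs \<le> k \<Longrightarrow> continuous_on S (iter_partial vs f)"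
  unfolding Ck_on_def by blast

text \<open>The increment bound is used twice: with \<open>L = 0\<close> on the first partials,
  where bounded second partials give a Lipschitz constant, and then on \<open>f\<close> with the
  partials frozen at \<open>x\<close>. The estimate concerns pairs of points, with relative error
  proportional to the radius around \<open>x\<close>; an expansion at \<open>x\<close> alone would
  not control differences of chart values.\<close>

lemma C2_strict_differentiability:
  fixes f :: "'a::euclidean_space \<Rightarrow> 'b::real_normed_vector"
  assumes f: "Ck_on 2 f S" and x: "x \<in> S"
  obtains C \<rho> where "C \<ge> 0" "\<rho> > 0" "cball x \<rho> \<subseteq> S"
    "\<And>r y z. r \<le> \<rho> \<Longrightarrow> y \<in> cball x r \<Longrightarrow> z \<in> cball x r \<Longrightarrow>
       norm (f y - f z - (\<Sum>b\<in>Basis. ((y - z) \<bullet> b) *\<^sub>R partial_dir f b x)) \<le> C * r * norm (y - z)"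
proof -
  have "open S" using f by (simp add: Ck_on_def)
  define Q where "Q r = cbox (x - (r::real) *\<^sub>R One) (x + r *\<^sub>R One)" for r
  have inQ: "y \<in> Q r" if "y \<in> cball x r" for y and r :: real
  proof -
    have "\<bar>(y - x) \<bullet> b\<bar> \<le> r" if "b \<in> Basis" for b
      using Basis_le_norm[OF that, of "y - x"] \<open>y \<in> cball x r\<close> by (simp add: dist_norm norm_minus_commute)
    then show ?thesis
      by (auto simp: Q_def mem_box inner_add_left inner_diff_left abs_le_iff algebra_simps)
  qed
  have Qin: "norm (y - x) \<le> DIM('a) * r" if "y \<in> Q r" for y and r :: real
  proof -
    have "norm (y - x) \<le> (\<Sum>b\<in>Basis. \<bar>(y - x) \<bullet> b\<bar>)" by (rule norm_le_l1)
    also have "\<dots> \<le> (\<Sum>b\<in>(Basis::'a set). r)"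
      using that by (intro sum_mono) (auto simp: Q_def mem_box inner_add_left inner_diff_left abs_le_iff algebra_simps)
    finally show ?thesis by simp
  qed
  obtain \<epsilon> where \<epsilon>: "\<epsilon> > 0" "cball x \<epsilon> \<subseteq> S"
    using \<open>open S\<close> x open_contains_cball by blast
  \<comment> \<open>The cube \<open>Q r\<close> contains the ball of radius \<open>r\<close> and
    lies in the ball of radius \<open>DIM('a) * r\<close>, so this choice keeps
    \<open>Q \<rho>\<close> inside \<open>S\<close>.\<close>
  define \<rho> where "\<rho> = \<epsilon> / DIM('a)"
  have \<rho>: "\<rho> > 0" using \<epsilon> by (simp add: \<rho>_def)
  have QS: "Q \<rho> \<subseteq> S"
  proof
    fix y assume "y \<in> Q \<rho>"
    then have "norm (y - x) \<le> \<epsilon>" using Qin[of y \<rho>] by (simp add: \<rho>_def)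
    then show "y \<in> S" using \<epsilon> by (auto simp: dist_norm norm_minus_commute)
  qed
  have "\<exists>B. \<forall>y\<in>Q \<rho>. norm (partial_dir (partial_dir f b) c y) \<le> B" if "b \<in> Basis" "c \<in> Basis" for b c
  proof -
    have "continuous_on S (iter_partial [c, b] f)"
      using that by (intro Ck_on_imp_continuous_on_partial[OF f]) auto
    then have "continuous_on (Q \<rho>) (partial_dir (partial_dir f b) c)"
      using continuous_on_subset[OF _ QS] by simp
    then have "compact (partial_dir (partial_dir f b) c ` Q \<rho>)"
      by (rule compact_continuous_image) (simp add: Q_def)
    then have "bounded (partial_dir (partial_dir f b) c ` Q \<rho>)" by (rule compact_imp_bounded)
    then show ?thesis by (auto simp: bounded_iff)
  qed
  then obtain B where B: "\<And>b c y. b \<in> Basis \<Longrightarrow> c \<in> Basis \<Longrightarrow> y \<in> Q \<rho> \<Longrightarrow> norm (partial_dir (partial_dir f b) c y) \<le> B b c"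
    by metis
  define M where "M = (\<Sum>b\<in>Basis. \<Sum>c\<in>Basis. \<bar>B b c\<bar>)"
  have M: "norm (partial_dir (partial_dir f b) c y) \<le> M" if "b \<in> Basis" "c \<in> Basis" "y \<in> Q \<rho>" for b c y
  proof -
    have "\<bar>B b c\<bar> \<le> (\<Sum>c\<in>Basis. \<bar>B b c\<bar>)" using that by (intro member_le_sum) auto
    also have "\<dots> \<le> M" unfolding M_def using that by (intro member_le_sum[where f="\<lambda>b. \<Sum>c\<in>Basis. \<bar>B b c\<bar>"]) (auto intro: sum_nonneg)
    finally show ?thesis using B[OF that] by linarith
  qed
  have M0: "M \<ge> 0" by (auto simp: M_def intro!: sum_nonneg)
  have lip: "norm (partial_dir f b y - partial_dir f b z) \<le> DIM('a) * M * norm (y - z)"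
    if "b \<in> Basis" "y \<in> Q \<rho>" "z \<in> Q \<rho>" for b y z
  proof -
    have "norm (partial_dir f b y - partial_dir f b z - (\<Sum>c\<in>Basis. ((y - z) \<bullet> c) *\<^sub>R (0::'b))) \<le> DIM('a) * M * norm (y - z)"
      using that QS M unfolding Q_def
      by (intro partials_increment_bound[where D="partial_dir (partial_dir f b)"] Ck_on_partials(2)[OF f]) auto
    then show ?thesis by simp
  qed
  show ?thesis
  proof
    show "DIM('a) * (DIM('a) * M * DIM('a)) \<ge> 0" using M0 by simp
    show "\<rho> > 0" by fact
    show "cball x \<rho> \<subseteq> S" using inQ QS by blast
    fix r :: real and y z assume r: "r \<le> \<rho>" and yz: "y \<in> cball x r" "z \<in> cball x r"
    have sub: "Q r \<subseteq> Q \<rho>"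
      using r by (auto simp: Q_def mem_box inner_add_left inner_diff_left) force+
    have xQ: "x \<in> Q \<rho>" using \<rho> by (intro inQ) simp
    have "norm (f y - f z - (\<Sum>b\<in>Basis. ((y - z) \<bullet> b) *\<^sub>R partial_dir f b x)) \<le> DIM('a) * (DIM('a) * M * (DIM('a) * r)) * norm (y - z)"
    proof (rule partials_increment_bound[of "x - r *\<^sub>R One" "x + r *\<^sub>R One" f "partial_dir f"])
      fix \<xi> b assume "\<xi> \<in> cbox (x - r *\<^sub>R One) (x + r *\<^sub>R One)" and b: "b \<in> (Basis::'a set)"
      then have \<xi>: "\<xi> \<in> Q r" by (simp add: Q_def)
      show "((\<lambda>t. f (\<xi> + t *\<^sub>R b)) has_vector_derivative partial_dir f b \<xi>) (at 0)"
        using \<xi> sub QS b by (intro Ck_on_partials(1)[OF f]) auto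
      have "norm (partial_dir f b \<xi> - partial_dir f b x) \<le> DIM('a) * M * norm (\<xi> - x)"
        using \<xi> sub xQ b by (intro lip) auto
      also have "\<dots> \<le> DIM('a) * M * (DIM('a) * r)"
        using M0 Qin[OF \<xi>] by (intro mult_left_mono) auto
      finally show "norm (partial_dir f b \<xi> - partial_dir f b x) \<le> DIM('a) * M * (DIM('a) * r)" .
    qed (use inQ yz in \<open>auto simp: Q_def\<close>)
    then show "norm (f y - f z - (\<Sum>b\<in>Basis. ((y - z) \<bullet> b) *\<^sub>R partial_dir f b x)) \<le> DIM('a) * (DIM('a) * M * DIM('a)) * r * norm (y - z)"
      by (simp add: mult_ac)
  qed
qed

section \<open>Submanifolds as graphs over the tangent space\<close>

text \<open>The submanifold condition supplies a total derivative, while the second-order estimate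
  is phrased with partials at the base point; this translates between the two.\<close>

lemma has_derivative_eq_partials:
  fixes f :: "'a::euclidean_space \<Rightarrow> 'b::real_normed_vector"
  assumes "(f has_derivative f') (at x)"
  shows "f' v = (\<Sum>b\<in>Basis. (v \<bullet> b) *\<^sub>R partial_dir f b x)"
proof -
  interpret bounded_linear f' using assms by (rule has_derivative_bounded_linear)
  have "partial_dir f b x = f' b" for b
  proof -
    have "((\<lambda>t. f (x + t *\<^sub>R b)) has_derivative (\<lambda>t. f' (t *\<^sub>R b))) (at 0)"
      by (rule has_derivative_compose[where g=f and f="\<lambda>t. x + t *\<^sub>R b"])
         (auto intro!: derivative_eq_intros assms)
    then have "((\<lambda>t. f (x + t *\<^sub>R b)) has_vector_derivative f' b) (at 0)"
      by (simp add: has_vector_derivative_def scaleR)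
    then show ?thesis unfolding partial_dir_def by (rule vector_derivative_at)
  qed
  then have "(\<Sum>b\<in>Basis. (v \<bullet> b) *\<^sub>R partial_dir f b x) = f' (\<Sum>b\<in>Basis. (v \<bullet> b) *\<^sub>R b)"
    by (simp add: sum scaleR)
  then show ?thesis by (simp add: euclidean_representation)
qed

text \<open>The graph is taken over the tangent space \<open>range \<iota>\<close> at \<open>x\<close>, where the normal part of an increment is
  of second order; hence \<open>s\<close> is an isometry up to a factor \<open>1 + O(r\<^sup>2)\<close> and neither an
  inverse function theorem nor an area formula is needed.\<close>

locale local_graph =
  fixes \<Omega> :: "'a::euclidean_space set" and x :: 'a and \<iota> :: "'b::euclidean_space \<Rightarrow> 'a"
    and \<pi> :: "'a \<Rightarrow> 'b" and s :: "'b \<Rightarrow> 'a" and \<rho> C :: real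
  assumes base: "x \<in> \<Omega>" and radius_pos: "\<rho> > 0" and C_nonneg: "C \<ge> 0"
    and linear_\<iota>: "linear \<iota>" and norm_\<iota>: "norm (\<iota> w) = norm w"
    and linear_\<pi>: "linear \<pi>" and norm_\<pi>_le: "norm (\<pi> y) \<le> norm y"
    and s_mem: "w \<in> ball 0 \<rho> \<Longrightarrow> s w \<in> \<Omega>"
    and \<pi>_s: "w \<in> ball 0 \<rho> \<Longrightarrow> \<pi> (s w - x) = w"
    and s_\<pi>: "y \<in> \<Omega> \<Longrightarrow> y \<in> ball x \<rho> \<Longrightarrow> s (\<pi> (y - x)) = y"
    and s_lipschitz: "r < \<rho> \<Longrightarrow> v \<in> cball 0 r \<Longrightarrow> w \<in> cball 0 r \<Longrightarrow>
       norm (s v - s w) \<le> (1 + C * r\<^sup>2) * norm (v - w)"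
    and s_tangent: "w \<in> ball 0 \<rho> \<Longrightarrow> norm (s w - x - \<iota> w) \<le> C * (norm w)\<^sup>2"

text \<open>Strict differentiability of the chart is used between two arbitrary nearby points: the
  normal projection annihilates \<open>A (v - w)\<close>, so the normal part of \<open>y - z\<close>
  is of order \<open>r * norm (y - z)\<close>. Hence orthogonal projection to the tangent space is
  injective near \<open>x\<close> and its inverse \<open>s\<close> is almost isometric. That the
  projection reaches a full ball is a separate, topological point.\<close>

lemma smooth_submanifold_local_graph:
  fixes \<Omega> :: "'a::euclidean_space set"
  assumes h0: "h0 > 0" and x: "x \<in> \<Omega>"
    and sub: "smooth_submanifold TYPE('b::euclidean_space) (ball x h0 \<inter> \<Omega>)"
  obtains \<iota> :: "'b::euclidean_space \<Rightarrow> 'a" and \<pi> s \<rho> C where "local_graph \<Omega> x \<iota> \<pi> s \<rho> C"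
proof -
  define M where "M = ball x h0 \<inter> \<Omega>"
  have xM: "x \<in> M" using x h0 by (simp add: M_def)
  obtain U V and \<phi> :: "'b \<Rightarrow> 'a" and \<phi>' where U: "open U" "x \<in> U" and V: "open V"
    and sm: "smooth_on \<phi> V" and hom: "homeomorphism V (M \<inter> U) \<phi> (inv_into V \<phi>)"
    and der: "\<And>v. v \<in> V \<Longrightarrow> (\<phi> has_derivative \<phi>' v) (at v) \<and> inj (\<phi>' v)"
    using sub xM unfolding smooth_submanifold_def M_def by meson
  have C2: "Ck_on 2 \<phi> V" using sm by (simp add: smooth_on_def)
  define v0 where "v0 = inv_into V \<phi> x"
  have v0: "v0 \<in> V" "\<phi> v0 = x"
    using hom xM U by (auto simp: homeomorphism_def v0_def)
  define A where "A = \<phi>' v0"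
  have A: "(\<phi> has_derivative A) (at v0)" "inj A" using der v0 by (auto simp: A_def)
  have linA: "linear A" using A(1) has_derivative_linear by blast
  obtain C0 \<rho>0 where C0: "C0 \<ge> 0" and \<rho>0: "\<rho>0 > 0" "cball v0 \<rho>0 \<subseteq> V"
    and strict: "\<And>r y z. r \<le> \<rho>0 \<Longrightarrow> y \<in> cball v0 r \<Longrightarrow> z \<in> cball v0 r \<Longrightarrow>
       norm (\<phi> y - \<phi> z - A (y - z)) \<le> C0 * r * norm (y - z)"
    using C2_strict_differentiability[OF C2 v0(1)] unfolding has_derivative_eq_partials[OF A(1), symmetric] by metis
  obtain m where m: "m > 0" "\<And>v. m * norm v \<le> norm (A v)"
    using linear_inj_bounded_below_pos[OF linA A(2)] by metis
  have "subspace (range A)" using linA by (simp add: linear_subspace_image)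
  moreover have "dim (UNIV :: 'b set) = dim (range A)"
    using dim_image_eq[OF linA, of UNIV] A(2) by simp
  ultimately obtain \<iota> :: "'b \<Rightarrow> 'a" where \<iota>: "linear \<iota>" "range \<iota> = range A" "\<And>w. norm (\<iota> w) = norm w"
    using isometry_subspaces[of "UNIV :: 'b set" "range A"] by (auto simp: subspace_UNIV)
  \<comment> \<open>The adjoint of an isometric embedding is the orthogonal projection onto its
    range, read in the coordinates of the parameter space.\<close>
  define \<pi> where "\<pi> = adjoint \<iota>"
  have lin\<pi>: "linear \<pi>" unfolding \<pi>_def using \<iota>(1) by (rule adjoint_linear)
  have adj: "w \<bullet> \<pi> y = \<iota> w \<bullet> y" for w y unfolding \<pi>_def by (rule adjoint_works[OF \<iota>(1)])
  have \<iota>_inner: "\<iota> v \<bullet> \<iota> w = v \<bullet> w" for v w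
    by (simp add: dot_norm \<iota>(3) flip: linear_add[OF \<iota>(1)])
  have \<pi>\<iota>: "\<pi> (\<iota> w) = w" for w
    using adj \<iota>_inner vector_eq_ldot by metis
  have \<pi>_le: "norm (\<pi> y) \<le> norm y" for y
  proof -
    have "norm (\<pi> y) * norm (\<pi> y) = \<iota> (\<pi> y) \<bullet> y" using adj[of "\<pi> y" y] by (simp add: power2_norm_eq_inner flip: power2_eq_square)
    also have "\<dots> \<le> norm (\<pi> y) * norm y" using norm_cauchy_schwarz[of "\<iota> (\<pi> y)" y] by (simp add: \<iota>(3))
    finally show ?thesis by (cases "norm (\<pi> y) = 0") (auto simp: mult_le_cancel_left_pos)
  qed
  define N where "N z = z - \<iota> (\<pi> z)" for z
  have linN: "linear N"
    unfolding N_def[abs_def] using linear_compose[OF lin\<pi> \<iota>(1)] by (intro linear_compose_sub) (auto simp: o_def linear_id[unfolded id_def])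
  have pyth: "(norm z)\<^sup>2 = (norm (\<pi> z))\<^sup>2 + (norm (N z))\<^sup>2" for z
  proof -
    have "(norm (N z))\<^sup>2 = z \<bullet> z - 2 * (\<iota> (\<pi> z) \<bullet> z) + \<iota> (\<pi> z) \<bullet> \<iota> (\<pi> z)"
      by (simp add: N_def power2_norm_eq_inner inner_diff_left inner_diff_right inner_commute)
    then show ?thesis by (simp add: \<iota>_inner \<pi>\<iota> flip: adj) (simp add: power2_norm_eq_inner)
  qed
  have N_le: "norm (N z) \<le> norm z" for z
    by (rule power2_le_imp_le) (use pyth[of z] in auto)
  have NA: "N (A v) = 0" for v
  proof -
    obtain w where "A v = \<iota> w" using \<iota>(2) by blast
    then show ?thesis by (simp add: N_def \<pi>\<iota>)
  qed
  \<comment> \<open>On this ball the nonlinear part of \<open>\<phi>\<close> is at most half of the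
    lower bound \<open>m\<close> for \<open>A\<close>, so distances shrink under
    \<open>\<phi>\<close> at most by the factor \<open>m / 2\<close>. The \<open>+ 1\<close> avoids
    division by zero.\<close>
  define \<delta> where "\<delta> = min \<rho>0 (m / (2 * (C0 + 1)))"
  have \<delta>: "\<delta> > 0" "\<delta> \<le> \<rho>0" "C0 * \<delta> \<le> m / 2"
  proof -
    have "C0 * \<delta> \<le> (C0 + 1) * (m / (2 * (C0 + 1)))"
      using C0 m by (intro mult_mono) (auto simp: \<delta>_def \<rho>0 less_imp_le)
    also have "\<dots> = m / 2" using C0 by (simp add: divide_simps)
    finally show "C0 * \<delta> \<le> m / 2" .
  qed (use \<rho>0 m C0 in \<open>auto simp: \<delta>_def\<close>)
  define k where "k = 2 / m"
  have k: "k > 0" using m by (simp add: k_def)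
  have expand: "norm (v - w) \<le> k * norm (\<phi> v - \<phi> w)" if "v \<in> cball v0 \<delta>" "w \<in> cball v0 \<delta>" for v w
  proof -
    have "m * norm (v - w) \<le> norm (A (v - w))" by (rule m)
    also have "\<dots> \<le> norm (\<phi> v - \<phi> w) + norm (\<phi> v - \<phi> w - A (v - w))"
      by (metis norm_minus_commute norm_triangle_sub)
    also have "norm (\<phi> v - \<phi> w - A (v - w)) \<le> (m / 2) * norm (v - w)"
      using strict[OF \<delta>(2) that] mult_right_mono[OF \<delta>(3), of "norm (v - w)"] by simp
    finally show ?thesis using m by (simp add: k_def field_simps)
  qed
  \<comment> \<open>One factor \<open>k\<close> turns a radius around \<open>x\<close> into a radius
    around \<open>v0\<close>, the other turns \<open>norm (v - w)\<close> into
    \<open>norm (y - z)\<close>.\<close>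
  define C1 where "C1 = C0 * k * k"
  have C1: "C1 \<ge> 0" using C0 k by (simp add: C1_def)
  \<comment> \<open>Here it matters that the chart is a homeomorphism onto a relatively open piece:
    no other sheet of \<open>\<Omega>\<close> comes back near \<open>x\<close>, so every nearby
    point of \<open>\<Omega>\<close> has a parameter near \<open>v0\<close>.\<close>
  have "openin (top_of_set (M \<inter> U)) (\<phi> ` (V \<inter> ball v0 \<delta>))"
    by (rule homeomorphism_imp_open_map[OF hom]) (auto simp: openin_open)
  then obtain T where T: "open T" "\<phi> ` (V \<inter> ball v0 \<delta>) = (M \<inter> U) \<inter> T" by (auto simp: openin_open)
  have "x \<in> T \<inter> U \<inter> ball x h0" using T(2) v0 \<delta> xM U by (auto simp: h0)
  moreover have "open (T \<inter> U \<inter> ball x h0)" using T U by auto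
  ultimately obtain \<epsilon> where \<epsilon>: "\<epsilon> > 0" "ball x \<epsilon> \<subseteq> T \<inter> U \<inter> ball x h0"
    using open_contains_ball by meson
  define \<rho>1 where "\<rho>1 = min \<epsilon> (1 / (2 * (C1 + 1)))"
  have \<rho>1: "\<rho>1 > 0" "\<rho>1 \<le> \<epsilon>" "C1 * \<rho>1 \<le> 1 / 2"
  proof -
    have "C1 * \<rho>1 \<le> (C1 + 1) * (1 / (2 * (C1 + 1)))"
      using C1 \<epsilon> by (intro mult_mono) (auto simp: \<rho>1_def)
    also have "\<dots> = 1 / 2" using C1 by (simp add: divide_simps)
    finally show "C1 * \<rho>1 \<le> 1 / 2" .
  qed (use \<epsilon> C1 in \<open>auto simp: \<rho>1_def\<close>)
  have chart: "\<exists>v \<in> ball v0 \<delta>. \<phi> v = y" if "y \<in> \<Omega>" "y \<in> ball x \<rho>1" for y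
  proof -
    have "y \<in> ball x \<epsilon>" using that \<rho>1 by auto
    then have "y \<in> (M \<inter> U) \<inter> T" using \<epsilon> that by (auto simp: M_def)
    then show ?thesis using T by (metis IntE imageE)
  qed
  have normal: "norm (N (y - z)) \<le> C1 * r * norm (y - z)"
    if y: "y \<in> \<Omega>" "y \<in> ball x \<rho>1" "norm (y - x) \<le> r" and z: "z \<in> \<Omega>" "z \<in> ball x \<rho>1" "norm (z - x) \<le> r" for y z r
  proof -
    obtain v w where v: "v \<in> ball v0 \<delta>" "\<phi> v = y" and w: "w \<in> ball v0 \<delta>" "\<phi> w = z"
      using chart y z by meson
    define r' where "r' = min (k * r) \<delta>"
    have *: "u \<in> cball v0 r'" if "u \<in> ball v0 \<delta>" "norm (\<phi> u - x) \<le> r" for u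
    proof -
      have "norm (u - v0) \<le> k * norm (\<phi> u - \<phi> v0)" using that \<delta> by (intro expand) auto
      also have "\<dots> \<le> k * r" using that v0 k by simp
      finally show ?thesis using that by (simp add: r'_def dist_norm norm_minus_commute)
    qed
    have "N (y - z) = N (\<phi> v - \<phi> w - A (v - w))" by (simp add: linear_diff[OF linN] NA v w)
    also have "norm \<dots> \<le> norm (\<phi> v - \<phi> w - A (v - w))" by (rule N_le)
    also have "\<dots> \<le> C0 * r' * norm (v - w)"
      using v w y z \<delta> by (intro strict *) (auto simp: r'_def)
    also have "\<dots> \<le> C0 * (k * r) * (k * norm (y - z))"
      using expand[of v w] v w C0 k \<delta> order_trans[OF norm_ge_zero y(3)] by (intro mult_mono) (auto simp: r'_def)
    finally show ?thesis by (simp add: C1_def mult_ac)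
  qed
  have stretch: "norm (y - z) \<le> (1 + C1\<^sup>2 * r\<^sup>2) * norm (\<pi> (y - z))"
    if y: "y \<in> \<Omega>" "y \<in> ball x \<rho>1" "norm (y - x) \<le> r" and z: "z \<in> \<Omega>" "z \<in> ball x \<rho>1" "norm (z - x) \<le> r" for y z r
  proof -
    \<comment> \<open>\<open>r\<close> is arbitrary, but the bound \<open>a \<le> 1 / 4\<close>
      below needs a radius of at most \<open>\<rho>1\<close>; both points lie in that ball
      anyway.\<close>
    define q where "q = min r \<rho>1"
    have q: "norm (y - x) \<le> q" "norm (z - x) \<le> q" "0 \<le> q" "q \<le> r"
      using y z \<rho>1 order_trans[OF norm_ge_zero y(3)] by (auto simp: q_def dist_norm norm_minus_commute)
    define a where "a = (C1 * q)\<^sup>2"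
    have "C1 * q \<le> 1 / 2" using \<rho>1(3) mult_left_mono[of q \<rho>1 C1] C1 by (simp add: q_def)
    then have "a \<le> (1/2)\<^sup>2" unfolding a_def using C1 q by (intro power_mono) auto
    then have a: "0 \<le> a" "a \<le> 1/4" by (auto simp: a_def power2_eq_square)
    have "(norm (N (y - z)))\<^sup>2 \<le> (C1 * q * norm (y - z))\<^sup>2"
      by (intro power_mono normal) (use y z q in auto)
    then have "(1 - a) * (norm (y - z))\<^sup>2 \<le> (norm (\<pi> (y - z)))\<^sup>2"
      using pyth[of "y - z"] by (simp add: a_def power_mult_distrib algebra_simps)
    then have "(1 + a)\<^sup>2 * ((1 - a) * (norm (y - z))\<^sup>2) \<le> (1 + a)\<^sup>2 * (norm (\<pi> (y - z)))\<^sup>2"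
      by (intro mult_left_mono) auto
    \<comment> \<open>This replaces a square root: Pythagoras gives a factor
      \<open>1 / sqrt (1 - a)\<close>, which is at most \<open>1 + a\<close> for
      \<open>0 \<le> a \<le> 1 / 4\<close>.\<close>
    moreover have "1 \<le> (1 + a)\<^sup>2 * (1 - a)"
    proof -
      have "(1 + a)\<^sup>2 * (1 - a) = 1 + a * (1 - a - a\<^sup>2)" by (simp add: power2_eq_square algebra_simps)
      moreover have "a\<^sup>2 \<le> (1/4)\<^sup>2" using a by (intro power_mono) auto
      then have "0 \<le> a * (1 - a - a\<^sup>2)" using a by (intro mult_nonneg_nonneg) (auto simp: power2_eq_square)
      ultimately show ?thesis by linarith
    qed
    then have "1 * (norm (y - z))\<^sup>2 \<le> (1 + a)\<^sup>2 * (1 - a) * (norm (y - z))\<^sup>2" by (intro mult_right_mono) auto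
    ultimately have "(norm (y - z))\<^sup>2 \<le> ((1 + a) * norm (\<pi> (y - z)))\<^sup>2"
      by (simp add: power_mult_distrib mult.assoc)
    then have "norm (y - z) \<le> (1 + a) * norm (\<pi> (y - z))" 
      by (rule power2_le_imp_le) (use a in auto)
    also have "\<dots> \<le> (1 + C1\<^sup>2 * r\<^sup>2) * norm (\<pi> (y - z))"
      using q by (intro mult_right_mono) (auto simp: a_def power_mult_distrib intro!: mult_left_mono power_mono)
    finally show ?thesis .
  qed
  have coarse: "norm (y - z) \<le> 2 * norm (\<pi> (y - z))"
    if y: "y \<in> \<Omega>" "y \<in> ball x \<rho>1" and z: "z \<in> \<Omega>" "z \<in> ball x \<rho>1" for y z
  proof -
    have "norm (y - z) \<le> (1 + C1\<^sup>2 * \<rho>1\<^sup>2) * norm (\<pi> (y - z))"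
      by (intro stretch) (use y z in \<open>auto simp: dist_norm norm_minus_commute\<close>)
    also have "C1\<^sup>2 * \<rho>1\<^sup>2 \<le> 1"
      using power_le_one[of "C1 * \<rho>1" 2] C1 \<rho>1 by (simp add: power_mult_distrib)
    finally have "norm (y - z) \<le> (1 + 1) * norm (\<pi> (y - z))" by (simp add: mult_right_mono)
    then show ?thesis by simp
  qed
  define S where "S = {v \<in> ball v0 \<delta>. \<phi> v \<in> ball x \<rho>1}"
  have cont: "continuous_on V \<phi>" using hom by (simp add: homeomorphism_def)
  have bV: "ball v0 \<delta> \<subseteq> V" using \<delta> \<rho>0 by (auto simp: subset_iff)
  have openS: "open S"
  proof -
    have "S = ball v0 \<delta> \<inter> \<phi> -` ball x \<rho>1" by (auto simp: S_def)
    also have "open \<dots>" using cont bV by (intro continuous_open_preimage) (auto intro: continuous_on_subset)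
    finally show ?thesis .
  qed
  have bij: "\<exists>g'. bounded_linear g' \<and> (\<lambda>v. \<pi> (A v)) \<circ> g' = id"
  proof -
    have lin: "linear (\<lambda>v. \<pi> (A v))" using linear_compose[OF linA lin\<pi>] by (simp add: o_def)
    have "surj (\<lambda>v. \<pi> (A v))"
    proof
      show "UNIV \<subseteq> range (\<lambda>v. \<pi> (A v))"
      proof
        fix w :: 'b
        obtain v where "\<iota> w = A v" using \<iota>(2) by blast
        then have "\<pi> (A v) = w" by (metis \<pi>\<iota>)
        then show "w \<in> range (\<lambda>v. \<pi> (A v))" by blast
      qed
    qed simp
    then show ?thesis using linear_surjective_right_inverse[OF lin] linear_conv_bounded_linear by blast
  qed
  then obtain g' where g': "bounded_linear g'" "(\<lambda>v. \<pi> (A v)) \<circ> g' = id" by blast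
  have bl\<pi>: "bounded_linear \<pi>" using lin\<pi> by (simp add: linear_conv_bounded_linear)
  \<comment> \<open>\<open>sussmann_open_mapping\<close> asks only for continuity and a
    right-invertible derivative at the single point \<open>v0\<close>. That derivative is
    \<open>\<pi>\<close> after \<open>A\<close>, which is onto because \<open>A\<close> and
    \<open>\<iota>\<close> have the same range.\<close>
  have "\<pi> (\<phi> v0 - x) \<in> interior ((\<lambda>v. \<pi> (\<phi> v - x)) ` S)"
  proof (rule sussmann_open_mapping[where f="\<lambda>v. \<pi> (\<phi> v - x)" and S="ball v0 \<delta>" and x=v0 and T=S and g'=g'])
    show "continuous_on (ball v0 \<delta>) (\<lambda>v. \<pi> (\<phi> v - x))"
      using bV by (intro bounded_linear.continuous_on[OF bl\<pi>] continuous_intros continuous_on_subset[OF cont])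
    show "((\<lambda>v. \<pi> (\<phi> v - x)) has_derivative (\<lambda>v. \<pi> (A v))) (at v0)"
      using A(1) by (auto intro!: bounded_linear.has_derivative[OF bl\<pi>] derivative_eq_intros)
    show "v0 \<in> interior S" using openS v0 \<delta> \<rho>1 by (simp add: interior_open S_def)
  qed (use g' \<delta> in \<open>auto simp: S_def\<close>)
  then have "0 \<in> interior ((\<lambda>v. \<pi> (\<phi> v - x)) ` S)" by (simp add: v0 linear_0[OF lin\<pi>])
  then obtain \<rho>2 where \<rho>2: "\<rho>2 > 0" "ball 0 \<rho>2 \<subseteq> (\<lambda>v. \<pi> (\<phi> v - x)) ` S"
    using mem_interior by metis
  have exs: "\<exists>y. y \<in> \<Omega> \<and> y \<in> ball x \<rho>1 \<and> \<pi> (y - x) = w" if w: "w \<in> ball 0 \<rho>2" for w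
  proof -
    have "w \<in> (\<lambda>v. \<pi> (\<phi> v - x)) ` S" using w \<rho>2(2) by blast
    then obtain v where v: "v \<in> S" "w = \<pi> (\<phi> v - x)" by blast
    then have "v \<in> V" using bV by (auto simp: S_def)
    then have "\<phi> v \<in> M" using hom unfolding homeomorphism_def by blast
    then show ?thesis using v by (intro exI[of _ "\<phi> v"]) (auto simp: S_def M_def)
  qed
  \<comment> \<open>By \<open>coarse\<close>, two points of \<open>\<Omega>\<close> in
    \<open>ball x \<rho>1\<close> with the same projection coincide, so on
    \<open>ball 0 \<rho>2\<close> the choice is forced.\<close>
  define s where "s w = (SOME y. y \<in> \<Omega> \<and> y \<in> ball x \<rho>1 \<and> \<pi> (y - x) = w)" for w
  have s: "s w \<in> \<Omega>" "s w \<in> ball x \<rho>1" "\<pi> (s w - x) = w" if "w \<in> ball 0 \<rho>2" for w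
    using someI_ex[OF exs[OF that]] unfolding s_def by auto
  define \<rho> where "\<rho> = min \<rho>1 \<rho>2"
  have sx: "norm (s w - x) \<le> 2 * norm w" if "w \<in> ball 0 \<rho>2" for w
    using coarse[of "s w" x] s[OF that] x \<rho>1 by auto
  \<comment> \<open>Both factors 4 come from \<open>norm (s w - x) \<le> 2 * norm w\<close>: points
    over the ball of radius \<open>r\<close> lie within \<open>2 * r\<close> of
    \<open>x\<close>.\<close>
  define C where "C = max (4 * C1\<^sup>2) (4 * C1)"
  have "local_graph \<Omega> x \<iota> \<pi> s \<rho> C"
  proof (rule local_graph.intro)
    show "linear \<iota>" "\<And>w. norm (\<iota> w) = norm w" "linear \<pi>" "\<And>y. norm (\<pi> y) \<le> norm y" "x \<in> \<Omega>" by fact+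
    show "\<rho> > 0" "C \<ge> 0" using \<rho>1 \<rho>2 C1 by (auto simp: \<rho>_def C_def)
    show "s w \<in> \<Omega>" "\<pi> (s w - x) = w" if "w \<in> ball 0 \<rho>" for w using that s by (simp_all add: \<rho>_def)
    show "s (\<pi> (y - x)) = y" if y: "y \<in> \<Omega>" "y \<in> ball x \<rho>" for y
    proof -
      have "norm (\<pi> (y - x)) < \<rho>2" using y \<pi>_le[of "y - x"] by (simp add: \<rho>_def dist_norm norm_minus_commute)
      then have w: "\<pi> (y - x) \<in> ball 0 \<rho>2" by simp
      have "norm (s (\<pi> (y - x)) - y) \<le> 2 * norm (\<pi> (s (\<pi> (y - x)) - y))"
        by (rule coarse) (use s[OF w] y in \<open>auto simp: \<rho>_def\<close>)
      also have "\<pi> (s (\<pi> (y - x)) - y) = \<pi> (s (\<pi> (y - x)) - x) - \<pi> (y - x)"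
        by (simp flip: linear_diff[OF lin\<pi>])
      also have "\<dots> = 0" using s[OF w] by simp
      finally show ?thesis by simp
    qed
    show "norm (s v - s w) \<le> (1 + C * r\<^sup>2) * norm (v - w)" if r: "r < \<rho>" "v \<in> cball 0 r" "w \<in> cball 0 r" for r v w
    proof -
      have vw: "v \<in> ball 0 \<rho>2" "w \<in> ball 0 \<rho>2" using r by (auto simp: \<rho>_def)
      have "norm (s v - s w) \<le> (1 + C1\<^sup>2 * (2 * r)\<^sup>2) * norm (\<pi> (s v - s w))"
        by (rule stretch) (use s vw sx[OF vw(1)] sx[OF vw(2)] r in auto)
      also have "\<pi> (s v - s w) = \<pi> (s v - x) - \<pi> (s w - x)" by (simp flip: linear_diff[OF lin\<pi>])
      also have "\<dots> = v - w" using s vw by simp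
      also have "(1 + C1\<^sup>2 * (2 * r)\<^sup>2) * norm (v - w) \<le> (1 + C * r\<^sup>2) * norm (v - w)"
        using mult_right_mono[of "4 * C1\<^sup>2" C "r\<^sup>2"]
        by (intro mult_right_mono) (auto simp: C_def power_mult_distrib)
      finally show ?thesis .
    qed
    show "norm (s w - x - \<iota> w) \<le> C * (norm w)\<^sup>2" if "w \<in> ball 0 \<rho>" for w
    proof -
      have w: "w \<in> ball 0 \<rho>2" using that by (simp add: \<rho>_def)
      have "norm (s w - x - \<iota> w) = norm (N (s w - x))" using s[OF w] by (simp add: N_def)
      also have "\<dots> \<le> C1 * norm (s w - x) * norm (s w - x)"
        by (rule normal) (use s[OF w] x \<rho>1 in auto)
      also have "\<dots> \<le> C1 * (2 * norm w) * (2 * norm w)"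
        using sx[OF w] C1 by (intro mult_mono) auto
      also have "\<dots> \<le> C * (norm w)\<^sup>2" 
        using mult_right_mono[of "4 * C1" C "(norm w)\<^sup>2"] by (simp add: C_def power2_eq_square)
      finally show ?thesis .
    qed
  qed
  then show thesis by (rule that)
qed

section \<open>The isodiametric inequality\<close>

text \<open>For \<open>a\<close> near the supremum of \<open>A\<close> and \<open>b\<close> near the
  infimum of \<open>B\<close>, the half-scale copies \<open>(A + b) / 2\<close> and
  \<open>(a + B) / 2\<close> both lie in \<open>S\<close> and meet only inside an interval of length
  \<open>e / 2\<close> around \<open>(a + b) / 2\<close>. \<open>S\<close> is any Borel set
  containing the midpoints, since the sum of two Borel sets need not be Borel.\<close>

lemma midpoint_measure_real_bounded:
  fixes A B S :: "real set"
  assumes [measurable]: "A \<in> sets borel" "B \<in> sets borel" "S \<in> sets borel"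
    and ne: "A \<noteq> {}" "B \<noteq> {}" and bd: "bounded A" "bounded B"
    and S: "\<And>a b. a \<in> A \<Longrightarrow> b \<in> B \<Longrightarrow> (a + b) / 2 \<in> S"
  shows "emeasure lborel A + emeasure lborel B \<le> 2 * emeasure lborel S"
proof (rule ennreal_le_epsilon)
  fix e :: real assume e: "e > 0"
  have bda: "bdd_above A" and bdb: "bdd_below B"
    using bd bounded_imp_bdd_above bounded_imp_bdd_below by auto
  obtain a where a: "a \<in> A" "Sup A - e / 2 < a"
    using less_cSupE[OF _ ne(1), of "Sup A - e / 2"] e by auto
  obtain b where b: "b \<in> B" "b < Inf B + e / 2"
    using cInf_lessD[OF ne(2), of "Inf B + e / 2"] e by auto
  define A1 where "A1 = (\<lambda>x. 2 * x - b) -` A"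
  define B1 where "B1 = (\<lambda>x. 2 * x - a) -` B"
  have [measurable]: "A1 \<in> sets borel" "B1 \<in> sets borel"
    unfolding A1_def B1_def by (auto intro!: measurable_sets_borel[of _ borel])
  have scale: "emeasure lborel X = 2 * emeasure lborel ((\<lambda>x. 2 * x - c) -` X)"
    if [measurable]: "X \<in> sets borel" for X and c :: real
  proof -
    have [measurable]: "(\<lambda>x. 2 * x - c) -` X \<in> sets borel"
      by (auto intro!: measurable_sets_borel[of _ borel])
    have "emeasure lborel X = (\<integral>\<^sup>+x. indicator X x \<partial>lborel)" by simp
    also have "\<dots> = ennreal \<bar>2\<bar> * (\<integral>\<^sup>+x. indicator X (- c + 2 * x) \<partial>lborel)"
      by (rule nn_integral_real_affine) auto
    also have "(\<lambda>x. indicator X (- c + 2 * x) :: ennreal) = indicator ((\<lambda>x. 2 * x - c) -` X)"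
      by (auto simp: fun_eq_iff indicator_def add.commute)
    finally show ?thesis by simp
  qed
  have sub: "A1 \<subseteq> S" "B1 \<subseteq> S"
  proof -
    show "A1 \<subseteq> S"
    proof
      fix x assume "x \<in> A1"
      then have "((2 * x - b) + b) / 2 \<in> S" using b by (intro S) (auto simp: A1_def)
      then show "x \<in> S" by simp
    qed
    show "B1 \<subseteq> S"
    proof
      fix x assume "x \<in> B1"
      then have "(a + (2 * x - a)) / 2 \<in> S" using a by (intro S) (auto simp: B1_def)
      then show "x \<in> S" by simp
    qed
  qed
  define J where "J = {(a + b - e / 2) / 2 .. (a + b + e / 2) / 2}"
  have inter: "A1 \<inter> B1 \<subseteq> J"
  proof
    fix x assume x: "x \<in> A1 \<inter> B1"
    then have "2 * x - b \<le> Sup A" "Inf B \<le> 2 * x - a"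
      by (auto simp: A1_def B1_def intro: cSup_upper bda cInf_lower bdb)
    then show "x \<in> J" using a b by (auto simp: J_def field_simps)
  qed
  have "emeasure lborel A + emeasure lborel B = 2 * (emeasure lborel A1 + emeasure lborel B1)"
    using scale[of A b] scale[of B a] by (simp add: A1_def B1_def distrib_left)
  also have "emeasure lborel A1 + emeasure lborel B1 = emeasure lborel (A1 \<union> B1) + emeasure lborel (A1 \<inter> B1)"
    by (rule emeasure_Un_Int) auto
  also have "\<dots> \<le> emeasure lborel S + emeasure lborel J"
    using sub inter by (intro add_mono emeasure_mono) (auto simp: J_def)
  also have "emeasure lborel J = ennreal (e / 2)"
    using e by (simp add: J_def field_simps)
  finally have "emeasure lborel A + emeasure lborel B \<le> 2 * (emeasure lborel S + ennreal (e / 2))"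
    by (simp add: mult_left_mono)
  also have "2 * (emeasure lborel S + ennreal (e / 2)) = 2 * emeasure lborel S + ennreal e"
  proof -
    have "2 * ennreal (e / 2) = ennreal e"
      using e by (simp flip: ennreal_numeral ennreal_mult')
    then show ?thesis by (simp add: distrib_left)
  qed
  finally show "emeasure lborel A + emeasure lborel B \<le> 2 * emeasure lborel S + ennreal e" .
qed

lemma midpoint_measure_real:
  fixes A B S :: "real set"
  assumes [measurable]: "A \<in> sets borel" "B \<in> sets borel" "S \<in> sets borel"
    and ne: "A \<noteq> {}" "B \<noteq> {}"
    and S: "\<And>a b. a \<in> A \<Longrightarrow> b \<in> B \<Longrightarrow> (a + b) / 2 \<in> S"
  shows "emeasure lborel A + emeasure lborel B \<le> 2 * emeasure lborel S"
proof -
  obtain a b where ab: "a \<in> A" "b \<in> B" using ne by auto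
  have lim: "(\<lambda>n. emeasure lborel (X \<inter> {- real n..real n})) \<longlonglongrightarrow> emeasure lborel X"
    if [measurable]: "X \<in> sets borel" for X
  proof -
    have "(\<lambda>n. emeasure lborel (X \<inter> {- real n..real n})) \<longlonglongrightarrow> emeasure lborel (\<Union>n. X \<inter> {- real n..real n})"
      by (rule Lim_emeasure_incseq) (auto simp: incseq_def)
    also have "(\<Union>n. X \<inter> {- real n..real n}) = X"
    proof -
      have "\<exists>n. x \<in> {- real n..real n}" for x
        using real_arch_simple[of "\<bar>x\<bar>"] by (auto simp: abs_le_iff) (metis minus_le_iff)
      then show ?thesis by blast
    qed
    finally show ?thesis .
  qed
  obtain N where N: "max \<bar>a\<bar> \<bar>b\<bar> \<le> real N" using real_arch_simple by blast
  show ?thesis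
  proof (rule LIMSEQ_le_const2)
    show "(\<lambda>n. emeasure lborel (A \<inter> {- real n..real n}) + emeasure lborel (B \<inter> {- real n..real n}))
       \<longlonglongrightarrow> emeasure lborel A + emeasure lborel B"
      by (intro tendsto_add lim) auto
    have "emeasure lborel (A \<inter> {- real n..real n}) + emeasure lborel (B \<inter> {- real n..real n})
         \<le> 2 * emeasure lborel S" if "n \<ge> N" for n
    proof (rule midpoint_measure_real_bounded)
      have "max \<bar>a\<bar> \<bar>b\<bar> \<le> real n" using N that by linarith
      then have "a \<in> {- real n..real n}" "b \<in> {- real n..real n}" by auto
      then show "A \<inter> {- real n..real n} \<noteq> {}" "B \<inter> {- real n..real n} \<noteq> {}" using ab by blast+
    qed (auto intro: S bounded_subset[OF bounded_closed_interval])
    then show "\<exists>N. \<forall>n\<ge>N. emeasure lborel (A \<inter> {- real n..real n}) + emeasure lborel (B \<inter> {- real n..real n})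
         \<le> 2 * emeasure lborel S" by blast
  qed
qed

text \<open>Levels are rescaled to \<open>{0<..<1}\<close> so that functions with different suprema
  can be compared at the same relative level \<open>t\<close>.\<close>

lemma layer_cake_unit_interval:
  fixes f :: "real \<Rightarrow> real"
  assumes [measurable]: "f \<in> borel_measurable borel"
    and f: "\<And>x. 0 \<le> f x" "\<And>x. f x \<le> M" and M: "M > 0"
  shows "(\<integral>\<^sup>+x. ennreal (f x) \<partial>lborel) =
    ennreal M * (\<integral>\<^sup>+t. indicator {0<..<1} t * emeasure lborel {x. M * t < f x} \<partial>lborel)"
proof -
  have 1: "ennreal (f x) = ennreal M * (\<integral>\<^sup>+t. indicator {0<..<1} t * indicator {x. M * t < f x} x \<partial>lborel)" for x
  proof -
    have "f x / M \<le> 1" "0 \<le> f x / M" using f[of x] M by auto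
    have "t < 1" if "M * t < f x" for t
      using that f(2)[of x] M by (smt (verit) mult_less_cancel_left2)
    then have "indicator {0<..<1} t * indicator {x. M * t < f x} x = (indicator {0<..<f x / M} t :: ennreal)" for t
      using M by (auto simp: indicator_def field_simps)
    then have "(\<integral>\<^sup>+t. indicator {0<..<1} t * indicator {x. M * t < f x} x \<partial>lborel) = ennreal (f x / M)"
      using \<open>0 \<le> f x / M\<close> by simp
    then show ?thesis using M f by (simp flip: ennreal_mult')
  qed
  have "(\<integral>\<^sup>+x. ennreal (f x) \<partial>lborel) = ennreal M * (\<integral>\<^sup>+x. \<integral>\<^sup>+t. indicator {0<..<1} t * indicator {x. M * t < f x} x \<partial>lborel \<partial>lborel)"
    by (subst 1) (simp add: nn_integral_cmult)
  also have "(\<integral>\<^sup>+x. \<integral>\<^sup>+t. indicator {0<..<1} t * indicator {x. M * t < f x} x \<partial>lborel \<partial>lborel)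
      = (\<integral>\<^sup>+t. \<integral>\<^sup>+x. indicator {0<..<1} t * indicator {x. M * t < f x} x \<partial>lborel \<partial>lborel)"
    by (rule lborel_pair.Fubini') measurable
  also have "\<dots> = (\<integral>\<^sup>+t. indicator {0<..<1} t * emeasure lborel {x. M * t < f x} \<partial>lborel)"
    by (intro nn_integral_cong) (simp add: nn_integral_cmult)
  finally show ?thesis .
qed

text \<open>Prekopa--Leindler is stated in squared form so that it makes sense for \<open>ennreal\<close>-valued functions.
  After normalising the suprema of \<open>f\<close> and \<open>g\<close> to 1, all superlevel sets below 1 are nonempty, so the
  one-dimensional Brunn--Minkowski inequality applies to each of them.\<close>

lemma prekopa_leindler_real_bounded:
  fixes f g h :: "real \<Rightarrow> real"
  assumes [measurable]: "f \<in> borel_measurable borel" "g \<in> borel_measurable borel" "h \<in> borel_measurable borel"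
    and nonneg: "\<And>x. 0 \<le> f x" "\<And>x. 0 \<le> g x" "\<And>x. 0 \<le> h x"
    and bdd: "bdd_above (range f)" "bdd_above (range g)"
    and fgh: "\<And>s t. f s * g t \<le> (h ((s + t) / 2))\<^sup>2"
  shows "(\<integral>\<^sup>+x. ennreal (f x) \<partial>lborel) * (\<integral>\<^sup>+x. ennreal (g x) \<partial>lborel) \<le> (\<integral>\<^sup>+x. ennreal (h x) \<partial>lborel)\<^sup>2"
proof (cases "(\<forall>x. f x = 0) \<or> (\<forall>x. g x = 0)")
  case True
  then show ?thesis by auto
next
  case False
  then obtain a b where ab: "f a > 0" "g b > 0" using nonneg by (metis less_eq_real_def)
  define M where "M = (SUP x. f x)"
  define N where "N = (SUP x. g x)"
  have fM: "f x \<le> M" and gN: "g x \<le> N" for x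
    using bdd by (auto simp: M_def N_def intro: cSUP_upper)
  have MN: "M > 0" "N > 0" using ab fM[of a] gN[of b] by auto
  define R where "R = sqrt (M * N)"
  have R: "R > 0" "R\<^sup>2 = M * N" using MN by (auto simp: R_def)
  \<comment> \<open>Truncating \<open>h\<close> at \<open>R\<close> keeps the level estimate, which
    only concerns levels below \<open>R\<close>, and provides the upper bound that the rescaled
    layer-cake formula requires.\<close>
  define k where "k x = min (h x) R" for x
  have [measurable]: "k \<in> borel_measurable borel" by (simp add: k_def[abs_def])
  have k: "0 \<le> k x" "k x \<le> R" "k x \<le> h x" for x using nonneg R by (auto simp: k_def)
  define F where "F = (\<integral>\<^sup>+x. ennreal (f x) \<partial>lborel)"
  define G where "G = (\<integral>\<^sup>+x. ennreal (g x) \<partial>lborel)"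
  define H where "H = (\<integral>\<^sup>+x. ennreal (k x) \<partial>lborel)"
  define F' where "F' = (\<integral>\<^sup>+t. indicator {0<..<1} t * emeasure lborel {x. M * t < f x} \<partial>lborel)"
  define G' where "G' = (\<integral>\<^sup>+t. indicator {0<..<1} t * emeasure lborel {x. N * t < g x} \<partial>lborel)"
  define H' where "H' = (\<integral>\<^sup>+t. indicator {0<..<1} t * emeasure lborel {x. R * t < k x} \<partial>lborel)"
  have FM: "F = ennreal M * F'" unfolding F_def F'_def
    using nonneg fM MN by (intro layer_cake_unit_interval) auto
  have GN: "G = ennreal N * G'" unfolding G_def G'_def
    using nonneg gN MN by (intro layer_cake_unit_interval) auto
  have HR: "H = ennreal R * H'" unfolding H_def H'_def
    using k R by (intro layer_cake_unit_interval) auto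
  have level: "emeasure lborel {x. M * t < f x} + emeasure lborel {x. N * t < g x} \<le> 2 * emeasure lborel {x. R * t < k x}"
    if t: "0 < t" "t < 1" for t
  proof (rule midpoint_measure_real)
    show "{x. M * t < f x} \<noteq> {}"
      using t MN less_cSupE[of "M * t" "range f"] by (auto simp: M_def[symmetric])
    show "{x. N * t < g x} \<noteq> {}"
      using t MN less_cSupE[of "N * t" "range g"] by (auto simp: N_def[symmetric])
    fix a b assume a: "a \<in> {x. M * t < f x}" and b: "b \<in> {x. N * t < g x}"
    have "(R * t)\<^sup>2 = (M * t) * (N * t)" by (simp add: power_mult_distrib R) (simp add: power2_eq_square)
    also have "\<dots> < f a * g b" using a b t MN nonneg(1)[of a] by (intro mult_strict_mono') auto
    also have "\<dots> \<le> (h ((a + b) / 2))\<^sup>2" by (rule fgh)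
    finally have "R * t < h ((a + b) / 2)" using nonneg(3) power_less_imp_less_base by blast
    then show "(a + b) / 2 \<in> {x. R * t < k x}" using R t by (auto simp: k_def)
  qed measurable
  have [measurable]: "(\<lambda>t. emeasure lborel {x. M * t < f x}) \<in> borel_measurable borel"
    "(\<lambda>t. emeasure lborel {x. N * t < g x}) \<in> borel_measurable borel"
    "(\<lambda>t. emeasure lborel {x. R * t < k x}) \<in> borel_measurable borel"
    by measurable
  have sum: "F' + G' \<le> 2 * H'"
  proof -
    have "F' + G' = (\<integral>\<^sup>+t. indicator {0<..<1} t * (emeasure lborel {x. M * t < f x} + emeasure lborel {x. N * t < g x}) \<partial>lborel)"
      unfolding F'_def G'_def by (simp add: distrib_left nn_integral_add)
    also have "\<dots> \<le> (\<integral>\<^sup>+t. 2 * (indicator {0<..<1} t * emeasure lborel {x. R * t < k x}) \<partial>lborel)"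
      using level by (intro nn_integral_mono) (auto simp: indicator_def)
    also have "\<dots> = 2 * H'" unfolding H'_def by (simp add: nn_integral_cmult)
    finally show ?thesis .
  qed
  \<comment> \<open>The arithmetic-geometric mean inequality. The level estimate is additive and so
    survives integration over \<open>t\<close>; the product form is extracted only
    afterwards.\<close>
  have main: "F' * G' \<le> H'\<^sup>2"
  proof (cases "H' = \<top>")
    case False
    then have "2 * H' < \<top>" by (simp add: ennreal_mult_less_top less_top)
    with sum have "F' + G' < \<top>" by (rule le_less_trans)
    then have "F' < \<top>" "G' < \<top>" by auto
    then obtain x y z where xyz: "F' = ennreal x" "G' = ennreal y" "H' = ennreal z" "x \<ge> 0" "y \<ge> 0" "z \<ge> 0"
      using False by (metis ennreal_cases less_top)
    then have "ennreal (x + y) \<le> ennreal (2 * z)" using sum by (simp add: ennreal_mult)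
    then have "x + y \<le> 2 * z" using xyz by (auto simp: ennreal_le_iff2 simp del: ennreal_plus)
    then have "(x + y)\<^sup>2 \<le> (2 * z)\<^sup>2" using xyz by (intro power_mono) auto
    moreover have "0 \<le> (x - y)\<^sup>2" by simp
    ultimately have "x * y \<le> z\<^sup>2" by (simp add: power2_eq_square algebra_simps)
    then show ?thesis using xyz by (simp add: ennreal_power flip: ennreal_mult)
  qed simp
  have "F * G = ennreal (R\<^sup>2) * (F' * G')"
    using MN by (simp add: FM GN R ennreal_mult mult_ac)
  also have "\<dots> \<le> ennreal (R\<^sup>2) * H'\<^sup>2" by (intro mult_left_mono main) auto
  also have "\<dots> = H\<^sup>2" using R(1) by (simp add: HR power_mult_distrib ennreal_power)
  also have "\<dots> \<le> (\<integral>\<^sup>+x. ennreal (h x) \<partial>lborel)\<^sup>2"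
    unfolding H_def using k by (intro power_mono nn_integral_mono ennreal_leI) auto
  finally show ?thesis by (simp add: F_def G_def)
qed

section \<open>Extension to unbounded functions and to finitely many coordinates\<close>

lemma nn_integral_SUP_truncation:
  assumes [measurable]: "f \<in> borel_measurable M"
  shows "(\<integral>\<^sup>+x. f x \<partial>M) = (SUP n. \<integral>\<^sup>+x. min (f x) (of_nat n) \<partial>M)"
proof -
  have "f x = (SUP n. min (f x) (of_nat n))" for x
    by (subst inf_min[symmetric], subst inf_SUP[symmetric])
       (simp add: ennreal_SUP_of_nat_eq_top)
  then have "(\<integral>\<^sup>+x. f x \<partial>M) = (\<integral>\<^sup>+x. (SUP n. min (f x) (of_nat n)) \<partial>M)" by simp
  also have "\<dots> = (SUP n. \<integral>\<^sup>+x. min (f x) (of_nat n) \<partial>M)"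
    by (intro nn_integral_monotone_convergence_SUP)
       (auto simp: incseq_def le_fun_def min_le_iff_disj)
  finally show ?thesis .
qed

lemma prekopa_leindler_real:
  fixes f g h :: "real \<Rightarrow> ennreal"
  assumes [measurable]: "f \<in> borel_measurable borel" "g \<in> borel_measurable borel" "h \<in> borel_measurable borel"
    and fgh: "\<And>s t. f s * g t \<le> (h ((s + t) / 2))\<^sup>2"
  shows "(\<integral>\<^sup>+x. f x \<partial>lborel) * (\<integral>\<^sup>+x. g x \<partial>lborel) \<le> (\<integral>\<^sup>+x. h x \<partial>lborel)\<^sup>2"
proof -
  have *: "(\<integral>\<^sup>+x. min (f x) (of_nat m) \<partial>lborel) * (\<integral>\<^sup>+x. min (g x) (of_nat n) \<partial>lborel) \<le> (\<integral>\<^sup>+x. h x \<partial>lborel)\<^sup>2" for m n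
  proof -
    \<comment> \<open>The product of the truncated factors is at most \<open>l * l\<close>, so
      truncating \<open>h\<close> at the larger of the two levels preserves the hypothesis.\<close>
    define l where "l = max m n"
    define f' where "f' x = enn2real (min (f x) (of_nat m))" for x
    define g' where "g' x = enn2real (min (g x) (of_nat n))" for x
    define h' where "h' x = enn2real (min (h x) (of_nat l))" for x
    have e: "ennreal (enn2real (min y (of_nat n))) = min y (of_nat n)" for y n
      by (intro ennreal_enn2real) (auto simp: min_less_iff_disj of_nat_less_top)
    have eqs: "ennreal (f' x) = min (f x) (of_nat m)" "ennreal (g' x) = min (g x) (of_nat n)" "ennreal (h' x) = min (h x) (of_nat l)" for x
      by (simp_all only: f'_def g'_def h'_def e)
    have bd: "enn2real (min y (of_nat n)) \<le> real n" for y n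
      by (rule enn2real_leI) (auto simp: ennreal_of_nat_eq_real_of_nat)
    have "(\<integral>\<^sup>+x. ennreal (f' x) \<partial>lborel) * (\<integral>\<^sup>+x. ennreal (g' x) \<partial>lborel) \<le> (\<integral>\<^sup>+x. ennreal (h' x) \<partial>lborel)\<^sup>2"
    proof (rule prekopa_leindler_real_bounded)
      show "bdd_above (range f')" "bdd_above (range g')" using bd by (auto simp: f'_def g'_def intro!: bdd_aboveI2)
      fix s t
      have "min (f s) (of_nat m) * min (g t) (of_nat n) \<le> (min (h ((s + t) / 2)) (of_nat l))\<^sup>2"
      proof (cases "h ((s + t) / 2) \<le> of_nat l")
        case True
        have "min (f s) (of_nat m) * min (g t) (of_nat n) \<le> f s * g t" by (intro mult_mono) auto
        then show ?thesis using fgh[of s t] True by (simp add: min_absorb1)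
      next
        case False
        have "min (f s) (of_nat m) * min (g t) (of_nat n) \<le> of_nat l * of_nat l"
          by (intro mult_mono) (auto simp: l_def min_le_iff_disj)
        then show ?thesis using False by (simp add: min_absorb2 power2_eq_square)
      qed
      then have "ennreal (f' s * g' t) \<le> ennreal ((h' ((s + t) / 2))\<^sup>2)"
        by (simp add: f'_def g'_def h'_def ennreal_mult ennreal_power[symmetric] e)
      then show "f' s * g' t \<le> (h' ((s + t) / 2))\<^sup>2" by (simp add: ennreal_le_iff)
    qed (auto simp: f'_def g'_def h'_def)
    also have "\<dots> \<le> (\<integral>\<^sup>+x. h x \<partial>lborel)\<^sup>2"
      by (intro power_mono nn_integral_mono) (auto simp: eqs)
    finally show ?thesis by (simp add: eqs)
  qed
  have "(\<integral>\<^sup>+x. f x \<partial>lborel) * (\<integral>\<^sup>+x. g x \<partial>lborel) =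
    (SUP m. SUP n. (\<integral>\<^sup>+x. min (f x) (of_nat m) \<partial>lborel) * (\<integral>\<^sup>+x. min (g x) (of_nat n) \<partial>lborel))"
    by (subst nn_integral_SUP_truncation[of f], simp, subst nn_integral_SUP_truncation[of g], simp)
       (simp add: SUP_mult_left_ennreal SUP_mult_right_ennreal, rule SUP_commute)
  also have "\<dots> \<le> (\<integral>\<^sup>+x. h x \<partial>lborel)\<^sup>2" by (intro SUP_least *)
  finally show ?thesis .
qed

text \<open>The functional form exists for this induction. The one-dimensional inequality says that
  the slice integrals of \<open>f\<close>, \<open>g\<close> and \<open>h\<close> again satisfy the
  hypothesis in the remaining coordinates. Slice integrals of indicators are no longer indicators
  and may be infinite, so an inequality for sets, or for real-valued functions, would not reproduce
  itself.\<close>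

lemma prekopa_leindler_PiM:
  fixes f g h :: "('i \<Rightarrow> real) \<Rightarrow> ennreal"
  assumes "finite I"
    and "f \<in> borel_measurable (\<Pi>\<^sub>M i\<in>I. lborel)" "g \<in> borel_measurable (\<Pi>\<^sub>M i\<in>I. lborel)" "h \<in> borel_measurable (\<Pi>\<^sub>M i\<in>I. lborel)"
    and "\<And>x y. x \<in> extensional I \<Longrightarrow> y \<in> extensional I \<Longrightarrow> f x * g y \<le> (h (\<lambda>i\<in>I. (x i + y i) / 2))\<^sup>2"
  shows "(\<integral>\<^sup>+x. f x \<partial>(\<Pi>\<^sub>M i\<in>I. lborel)) * (\<integral>\<^sup>+x. g x \<partial>(\<Pi>\<^sub>M i\<in>I. lborel)) \<le> (\<integral>\<^sup>+x. h x \<partial>(\<Pi>\<^sub>M i\<in>I. lborel))\<^sup>2"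
  using assms
proof (induction I arbitrary: f g h rule: finite_induct)
  interpret product_sigma_finite "\<lambda>_::'i. lborel :: real measure" by standard
  case empty
  then show ?case
    using empty(4)[of "\<lambda>_. undefined" "\<lambda>_. undefined"] by (simp add: PiM_empty nn_integral_count_space_finite)
next
  interpret product_sigma_finite "\<lambda>_::'i. lborel :: real measure" by standard
  case (insert i I)
  note [measurable] = insert.prems(1-3)
  let ?P = "\<Pi>\<^sub>M i\<in>I. (lborel :: real measure)"
  have sp: "space ?P = extensional I" by (auto simp: space_PiM PiE_def)
  have eq: "(\<integral>\<^sup>+x. k x \<partial>(\<Pi>\<^sub>M i\<in>insert i I. lborel)) = (\<integral>\<^sup>+x. (\<integral>\<^sup>+s. k (x(i := s)) \<partial>lborel) \<partial>?P)"
    if "k \<in> borel_measurable (\<Pi>\<^sub>M i\<in>insert i I. lborel)" for k :: "_ \<Rightarrow> ennreal"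
    using insert.hyps that by (intro product_nn_integral_insert) auto
  have upd: "x(i := s) \<in> extensional (insert i I)" if "x \<in> extensional I" for x and s :: real
    using that by (auto simp: extensional_def)
  have slice: "(\<lambda>s. k (x(i := s))) \<in> borel_measurable borel"
    if [measurable]: "k \<in> borel_measurable (\<Pi>\<^sub>M i\<in>insert i I. lborel)" and "x \<in> extensional I" for k :: "_ \<Rightarrow> ennreal" and x :: "'i \<Rightarrow> real"
  proof -
    have "x \<in> space ?P" using that sp by simp
    then have "(\<lambda>s. x(i := s)) \<in> lborel \<rightarrow>\<^sub>M (\<Pi>\<^sub>M i\<in>insert i I. lborel)"
      by measurable
    from measurable_compose[OF this that(1)] show ?thesis by simp
  qed
  show ?case
    unfolding eq[OF insert.prems(1)] eq[OF insert.prems(2)] eq[OF insert.prems(3)]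
  proof (rule insert.IH)
    fix x y :: "'i \<Rightarrow> real" assume x: "x \<in> extensional I" and y: "y \<in> extensional I"
    let ?m = "\<lambda>i\<in>I. (x i + y i) / 2"
    show "(\<integral>\<^sup>+s. f (x(i := s)) \<partial>lborel) * (\<integral>\<^sup>+s. g (y(i := s)) \<partial>lborel) \<le> (\<integral>\<^sup>+s. h (?m(i := s)) \<partial>lborel)\<^sup>2"
    proof (rule prekopa_leindler_real)
      fix s t :: real
      have "f (x(i := s)) * g (y(i := t)) \<le> (h (\<lambda>j\<in>insert i I. ((x(i := s)) j + (y(i := t)) j) / 2))\<^sup>2"
        by (intro insert.prems(4) upd x y)
      also have "(\<lambda>j\<in>insert i I. ((x(i := s)) j + (y(i := t)) j) / 2) = ?m(i := (s + t) / 2)"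
        using insert.hyps by (auto simp: fun_eq_iff)
      finally show "f (x(i := s)) * g (y(i := t)) \<le> (h (?m(i := (s + t) / 2)))\<^sup>2" .
    qed (auto intro!: slice insert.prems x y)
  qed measurable
qed

text \<open>The midpoints of \<open>C\<close> and its reflection form exactly the half difference
  set, so indicator functions in Prekopa--Leindler bound the product of the volumes of
  \<open>C\<close> and \<open>-C\<close> by the square of its volume; reflection preserves volume.
  Compactness makes the difference set Borel and all volumes finite, so the square root may be
  taken.\<close>

lemma emeasure_half_difference_set:
  fixes C :: "'a::euclidean_space set"
  assumes C: "compact C"
  shows "emeasure lborel C \<le> emeasure lborel ((\<lambda>(x, y). (1/2) *\<^sub>R (x - y)) ` (C \<times> C))" (is "_ \<le> emeasure lborel ?D")
proof -
  let ?C' = "uminus ` C"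
  define T :: "('a \<Rightarrow> real) \<Rightarrow> 'a" where "T u = (\<Sum>b\<in>Basis. u b *\<^sub>R b)" for u
  have cD: "compact ?D"
    using C by (intro compact_continuous_image compact_Times) (auto simp: case_prod_beta intro!: continuous_intros)
  have cC': "compact ?C'" by (intro compact_continuous_image C continuous_intros)
  have [measurable]: "C \<in> sets borel" "?C' \<in> sets borel" "?D \<in> sets borel"
    using C cD cC' by (auto intro: borel_closed compact_imp_closed)
  have [measurable]: "T \<in> (\<Pi>\<^sub>M b\<in>Basis. lborel) \<rightarrow>\<^sub>M borel"
    unfolding T_def[abs_def] by measurable
  have rep: "emeasure lborel X = (\<integral>\<^sup>+u. indicator X (T u) \<partial>(\<Pi>\<^sub>M b\<in>Basis. lborel))" if [measurable]: "X \<in> sets borel" for X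
  proof -
    have "emeasure lborel X = (\<integral>\<^sup>+x. indicator X x \<partial>lborel)" by simp
    also have "\<dots> = (\<integral>\<^sup>+x. indicator X x \<partial>(distr (\<Pi>\<^sub>M b\<in>Basis. lborel) borel T))"
      by (subst lborel_eq) (simp add: T_def[abs_def])
    also have "\<dots> = (\<integral>\<^sup>+u. indicator X (T u) \<partial>(\<Pi>\<^sub>M b\<in>Basis. lborel))"
      by (rule nn_integral_distr) auto
    finally show ?thesis .
  qed
  have PL: "emeasure lborel C * emeasure lborel ?C' \<le> (emeasure lborel ?D)\<^sup>2"
    unfolding rep[OF \<open>C \<in> sets borel\<close>] rep[OF \<open>?C' \<in> sets borel\<close>] rep[OF \<open>?D \<in> sets borel\<close>]
  proof (rule prekopa_leindler_PiM)
    fix u v :: "'a \<Rightarrow> real"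
    have "T (\<lambda>i\<in>Basis. (u i + v i) / 2) = (1/2) *\<^sub>R (T u - (- T v))"
      by (simp add: T_def scaleR_sum_right sum.distrib[symmetric] algebra_simps add_divide_distrib)
    then have "T (\<lambda>i\<in>Basis. (u i + v i) / 2) \<in> ?D" if "T u \<in> C" "T v \<in> ?C'"
      using that by (force simp: image_iff)
    then show "indicator C (T u) * indicator ?C' (T v) \<le> (indicator ?D (T (\<lambda>i\<in>Basis. (u i + v i) / 2)) :: ennreal)\<^sup>2"
      by (auto simp: indicator_def)
  qed auto
  have "emeasure lborel ?C' = emeasure lborel C"
  proof -
    have "(lborel :: 'a measure) = density (distr lborel borel (\<lambda>x. 0 + (-1) *\<^sub>R x)) (\<lambda>_. ennreal (\<bar>-1\<bar> ^ DIM('a)))"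
      by (rule lborel_affine) auto
    then have "(lborel :: 'a measure) = distr lborel borel (\<lambda>x. - x)" by (simp add: density_1)
    then have "emeasure lborel ?C' = emeasure (distr lborel borel (\<lambda>x::'a. - x)) ?C'" by simp
    also have "\<dots> = emeasure lborel (uminus -` ?C')" by (subst emeasure_distr) auto
    also have "uminus -` ?C' = C" by force
    finally show ?thesis .
  qed
  with PL have PL: "(emeasure lborel C)\<^sup>2 \<le> (emeasure lborel ?D)\<^sup>2" by (simp add: power2_eq_square)
  have fin: "emeasure lborel X = ennreal (measure lborel X)" if "compact X" for X :: "'a set"
    using emeasure_compact_finite[OF that] by (simp add: emeasure_eq_ennreal_measure less_top)
  have "(measure lborel C)\<^sup>2 \<le> (measure lborel ?D)\<^sup>2"
    using PL unfolding fin[OF C] fin[OF cD] by (simp add: ennreal_power)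
  then have "measure lborel C \<le> measure lborel ?D" by (rule power2_le_imp_le) simp
  then show ?thesis unfolding fin[OF C] fin[OF cD] by (simp add: ennreal_leI)
qed

text \<open>A set of diameter \<open>r\<close> need not fit into a ball of diameter
  \<open>r\<close>, as an equilateral triangle shows. Its half difference set does, being contained
  in the ball of radius \<open>r / 2\<close> around the origin, and it has at least the same volume.
  Taking the closure gives compactness without changing the diameter.\<close>

theorem isodiametric_inequality:
  fixes C :: "'a::euclidean_space set"
  assumes "bounded C"
  shows "emeasure lborel (closure C) \<le> ennreal (unit_ball_vol (real DIM('a)) * (diameter C / 2) ^ DIM('a))"
proof -
  let ?D = "(\<lambda>(x, y). (1/2) *\<^sub>R (x - y)) ` (closure C \<times> closure C)"
  have "emeasure lborel (closure C) \<le> emeasure lborel ?D"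
    using assms by (intro emeasure_half_difference_set) simp
  also have "\<dots> \<le> emeasure lborel (cball (0::'a) (diameter C / 2))"
  proof (rule emeasure_mono)
    show "?D \<subseteq> cball 0 (diameter C / 2)"
    proof clarify
      fix x y assume "x \<in> closure C" "y \<in> closure C"
      then have "dist x y \<le> diameter (closure C)"
        using assms by (intro diameter_bounded_bound) auto
      then show "(1/2) *\<^sub>R (x - y) \<in> cball 0 (diameter C / 2)"
        using assms by (simp add: diameter_closure dist_norm)
    qed
  qed simp
  also have "\<dots> = ennreal (unit_ball_vol (real DIM('a)) * (diameter C / 2) ^ DIM('a))"
    using assms by (intro emeasure_cball) (simp add: diameter_ge_0)
  finally show ?thesis .
qed

section \<open>Hausdorff measure under Lipschitz maps\<close>

text \<open>A cover of \<open>S\<close> is pushed through the contraction \<open>f\<close> to a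
  cover of \<open>E\<close> by sets of no larger diameter, and the isodiametric inequality dominates
  the volume of each piece by its term in the sum. Covering sets are arbitrary, hence the closures.
  The bound holds at every scale, so the single scale \<open>1\<close> serves for the
  supremum.\<close>

theorem lborel_le_hausdorff_outer:
  fixes f :: "'a::metric_space \<Rightarrow> 'b::euclidean_space"
  assumes lip: "\<And>x y. x \<in> S \<Longrightarrow> y \<in> S \<Longrightarrow> dist (f x) (f y) \<le> dist x y" and E: "E \<subseteq> f ` S"
  shows "emeasure lborel E \<le> hausdorff_outer DIM('b) S"
  unfolding hausdorff_outer_def
proof (rule SUP_upper2[of "1::real"], simp, rule INF_greatest)
  fix C :: "nat \<Rightarrow> 'a set"
  assume "C \<in> {C. S \<subseteq> \<Union> (range C) \<and> (\<forall>i. bounded (C i) \<and> diameter (C i) \<le> 1)}"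
  then have C: "S \<subseteq> \<Union> (range C)" "\<And>i. bounded (C i)" by auto
  define D where "D i = f ` (S \<inter> C i)" for i
  have dist: "dist x y \<le> diameter (C i)" if xy: "x \<in> D i" "y \<in> D i" for x y i
  proof -
    obtain u v where "u \<in> S \<inter> C i" "v \<in> S \<inter> C i" "x = f u" "y = f v"
      using xy unfolding D_def by blast
    then have "dist x y \<le> dist u v" "dist u v \<le> diameter (C i)"
      using lip diameter_bounded_bound[OF C(2)] by auto
    then show ?thesis by linarith
  qed
  have bdd: "bounded (D i)" for i
    unfolding bounded_two_points using dist by blast
  have diam: "diameter (D i) \<le> diameter (C i)" for i
    using dist diameter_ge_0[OF C(2)] by (intro diameter_le) (auto simp: dist_norm)
  have "E \<subseteq> (\<Union>i. D i)"
  proof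
    fix y assume "y \<in> E"
    then obtain x where x: "x \<in> S" "y = f x" using E by blast
    then obtain i where "x \<in> C i" using C(1) by blast
    then show "y \<in> (\<Union>i. D i)" using x by (auto simp: D_def)
  qed
  also have "\<dots> \<subseteq> (\<Union>i. closure (D i))" by (rule UN_mono[OF order_refl closure_subset])
  finally have "emeasure lborel E \<le> emeasure lborel (\<Union>i. closure (D i))"
    by (rule emeasure_mono) auto
  also have "\<dots> \<le> (\<Sum>i. emeasure lborel (closure (D i)))"
    by (rule emeasure_subadditive_countably) auto
  also have "\<dots> \<le> (\<Sum>i. ennreal (unit_ball_vol (real DIM('b)) * (diameter (C i) / 2) ^ DIM('b)))"
  proof (rule suminf_le)
    fix i
    have "emeasure lborel (closure (D i)) \<le> ennreal (unit_ball_vol (real DIM('b)) * (diameter (D i) / 2) ^ DIM('b))"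
      by (rule isodiametric_inequality[OF bdd])
    also have "\<dots> \<le> ennreal (unit_ball_vol (real DIM('b)) * (diameter (C i) / 2) ^ DIM('b))"
      using diam[of i] diameter_ge_0[OF bdd, of i] by (intro ennreal_leI mult_left_mono power_mono) auto
    finally show "emeasure lborel (closure (D i)) \<le> ennreal (unit_ball_vol (real DIM('b)) * (diameter (C i) / 2) ^ DIM('b))" .
  qed auto
  finally show "emeasure lborel E \<le> (\<Sum>i. ennreal (unit_ball_vol (real DIM('b)) * (diameter (C i) / 2) ^ DIM('b)))" .
qed

section \<open>Covers by small balls of nearly minimal total volume\<close>

lemma disjoint_cballs_emeasure_le:
  fixes P :: "('b::euclidean_space \<times> real) set"
  assumes "countable P" and "pairwise (\<lambda>i j. disjnt (cball (fst i) (snd i)) (cball (fst j) (snd j))) P"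
    and "open W" and "\<And>p. p \<in> P \<Longrightarrow> cball (fst p) (snd p) \<subseteq> W"
  shows "(\<integral>\<^sup>+p. emeasure lborel (cball (fst p) (snd p)) \<partial>count_space P) \<le> emeasure lborel W"
proof -
  have "(\<integral>\<^sup>+p. emeasure lborel (cball (fst p) (snd p)) \<partial>count_space P) = emeasure lborel (\<Union>p\<in>P. cball (fst p) (snd p))"
    using assms(1,2) by (intro emeasure_UN_countable[symmetric]) (auto simp: disjoint_family_on_def pairwise_def disjnt_def)
  also have "\<dots> \<le> emeasure lborel W"
    using assms by (intro emeasure_mono) auto
  finally show ?thesis .
qed

text \<open>The Vitali theorem leaves a null set uncovered, whereas a Hausdorff cover must reach
  every point; this lemma pays for the remainder. Disjoint balls inside an open superset of tiny
  volume cover \<open>N\<close> after fivefold enlargement, which explains the factor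
  \<open>5 ^ DIM('b)\<close> in \<open>e'\<close> and the radius bound
  \<open>\<eta> / 5\<close>.\<close>

lemma negligible_cball_cover:
  fixes N :: "'b::euclidean_space set"
  assumes N: "negligible N" and "\<eta> > 0" "e > 0"
  obtains P :: "('b \<times> real) set" where "countable P" "\<And>p. p \<in> P \<Longrightarrow> 0 < snd p \<and> snd p < \<eta>"
    "N \<subseteq> (\<Union>p\<in>P. cball (fst p) (snd p))"
    "(\<integral>\<^sup>+p. emeasure lborel (cball (fst p) (snd p)) \<partial>count_space P) \<le> ennreal e"
proof -
  define e' where "e' = e / 5 ^ DIM('b)"
  have e': "e' > 0" using \<open>e > 0\<close> by (simp add: e'_def)
  have Nnull: "N \<in> null_sets lebesgue" using N by (simp add: negligible_iff_null_sets)
  obtain W where W: "open W" "N \<subseteq> W" "emeasure lebesgue (W - N) < ennreal e'"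
    using sets_lebesgue_outer_open[OF null_setsD2[OF Nnull] e'] by metis
  have Wm: "emeasure lborel W \<le> ennreal e'"
  proof -
    have "emeasure lebesgue W = emeasure lebesgue (W - N)"
      using Nnull W(1) by (intro emeasure_Diff_null_set[symmetric]) (auto simp: sets_completionI_sets)
    then show ?thesis using W by simp
  qed
  define K where "K = {p :: 'b \<times> real. 0 < snd p \<and> snd p < \<eta> / 5 \<and> cball (fst p) (snd p) \<subseteq> W}"
  have "N \<subseteq> (\<Union>p\<in>K. cball (fst p) (snd p))"
  proof
    fix x assume "x \<in> N"
    then obtain r where r: "r > 0" "cball x r \<subseteq> W" using W open_contains_cball by blast
    define r' where "r' = min r (\<eta> / 6)"
    have "(x, r') \<in> K" using r \<open>\<eta> > 0\<close> by (auto simp: K_def r'_def)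
    moreover have "x \<in> cball x r'" using r \<open>\<eta> > 0\<close> by (auto simp: r'_def)
    ultimately show "x \<in> (\<Union>p\<in>K. cball (fst p) (snd p))" by force
  qed
  then obtain Q where Q: "countable Q" "Q \<subseteq> K"
     "pairwise (\<lambda>i j. disjnt (cball (fst i) (snd i)) (cball (fst j) (snd j))) Q"
     "N \<subseteq> (\<Union>p\<in>Q. cball (fst p) (5 * snd p))"
    by (rule Vitali_covering_lemma_cballs[where S=N and K=K and a=fst and r=snd and B="\<eta> / 5"]) (auto simp: K_def)
  define g where "g p = (fst p, 5 * snd p)" for p :: "'b \<times> real"
  have bij: "bij_betw g Q (g ` Q)" by (auto simp: bij_betw_def inj_on_def g_def prod_eq_iff)
  show ?thesis
  proof
    show "countable (g ` Q)" using Q by simp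
    show "\<And>p. p \<in> g ` Q \<Longrightarrow> 0 < snd p \<and> snd p < \<eta>" using Q(2) by (auto simp: K_def g_def)
    show "N \<subseteq> (\<Union>p\<in>g ` Q. cball (fst p) (snd p))" using Q(4) by (simp add: g_def)
    have "(\<integral>\<^sup>+p. emeasure lborel (cball (fst p) (snd p)) \<partial>count_space (g ` Q)) =
       (\<integral>\<^sup>+p. emeasure lborel (cball (fst (g p)) (snd (g p))) \<partial>count_space Q)"
      by (rule nn_integral_bij_count_space[OF bij, symmetric])
    also have "\<dots> = (\<integral>\<^sup>+p. ennreal (5 ^ DIM('b)) * emeasure lborel (cball (fst p) (snd p)) \<partial>count_space Q)"
    proof (rule nn_integral_cong)
      fix p assume "p \<in> space (count_space Q)"
      then have "snd p \<ge> 0" using Q(2) by (auto simp: K_def)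
      then show "emeasure lborel (cball (fst (g p)) (snd (g p))) = ennreal (5 ^ DIM('b)) * emeasure lborel (cball (fst p) (snd p))"
        by (simp add: g_def emeasure_cball power_mult_distrib mult_ac flip: ennreal_mult')
    qed
    also have "\<dots> = ennreal (5 ^ DIM('b)) * (\<integral>\<^sup>+p. emeasure lborel (cball (fst p) (snd p)) \<partial>count_space Q)"
      by (rule nn_integral_cmult) simp
    also have "\<dots> \<le> ennreal (5 ^ DIM('b)) * ennreal e'"
      using Q W(1) by (intro mult_left_mono order_trans[OF disjoint_cballs_emeasure_le Wm]) (auto simp: K_def)
    also have "\<dots> = ennreal e" using \<open>e > 0\<close> by (simp add: e'_def flip: ennreal_mult')
    finally show "(\<integral>\<^sup>+p. emeasure lborel (cball (fst p) (snd p)) \<partial>count_space (g ` Q)) \<le> ennreal e" .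
  qed
qed

text \<open>Disjoint balls inside an open set slightly larger than \<open>E\<close> waste no volume
  on overlaps; half of \<open>e\<close> pays for the excess of that open set and half for the null
  set the balls miss. An enlargement argument alone would lose a factor
  \<open>5 ^ DIM('b)\<close>.\<close>

lemma fine_cball_cover:
  fixes E :: "'b::euclidean_space set"
  assumes E: "E \<in> sets borel" and "\<eta> > 0" "e > 0"
  obtains P :: "('b \<times> real) set" where "countable P" "\<And>p. p \<in> P \<Longrightarrow> 0 < snd p \<and> snd p < \<eta>"
    "E \<subseteq> (\<Union>p\<in>P. cball (fst p) (snd p))"
    "(\<integral>\<^sup>+p. emeasure lborel (cball (fst p) (snd p)) \<partial>count_space P) \<le> emeasure lborel E + ennreal e"
proof -
  obtain W where W: "open W" "E \<subseteq> W" "emeasure lborel (W - E) < ennreal (e / 2)"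
    using outer_regular_lborel[OF E, of "e / 2"] \<open>e > 0\<close> by auto
  have Wm: "emeasure lborel W \<le> emeasure lborel E + ennreal (e / 2)"
  proof -
    have "emeasure lborel W = emeasure lborel (E \<union> (W - E))" using W by (simp add: Un_absorb1)
    also have "\<dots> \<le> emeasure lborel E + emeasure lborel (W - E)"
      using E W by (intro emeasure_subadditive) auto
    also have "\<dots> \<le> emeasure lborel E + ennreal (e / 2)" using W by (intro add_left_mono) auto
    finally show ?thesis .
  qed
  define K where "K = {p :: 'b \<times> real. 0 < snd p \<and> snd p < \<eta> \<and> cball (fst p) (snd p) \<subseteq> W}"
  have "\<exists>p. p \<in> K \<and> x \<in> cball (fst p) (snd p) \<and> snd p < t" if xt: "x \<in> E" "t > 0" for x t
  proof -
    have "x \<in> W" using W xt by blast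
    then obtain r where r: "r > 0" "cball x r \<subseteq> W" using W open_contains_cball by blast
    define r' where "r' = min r (min (\<eta> / 2) (t / 2))"
    have r': "r' > 0" "r' \<le> r" "r' < \<eta>" "r' < t" using r \<open>\<eta> > 0\<close> xt by (auto simp: r'_def)
    then have "cball x r' \<subseteq> W" using r(2) by (meson order_trans subset_cball)
    then show ?thesis using r' by (intro exI[of _ "(x, r')"]) (auto simp: K_def)
  qed
  then obtain P1 where P1: "countable P1" "P1 \<subseteq> K"
     "pairwise (\<lambda>i j. disjnt (cball (fst i) (snd i)) (cball (fst j) (snd j))) P1"
     "negligible (E - (\<Union>p\<in>P1. cball (fst p) (snd p)))"
    by (rule Vitali_covering_theorem_cballs[where K=K and r=snd and S=E and a=fst, rotated]) (auto simp: K_def)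
  obtain P2 :: "('b \<times> real) set" where P2: "countable P2" "\<And>p. p \<in> P2 \<Longrightarrow> 0 < snd p \<and> snd p < \<eta>"
    "E - (\<Union>p\<in>P1. cball (fst p) (snd p)) \<subseteq> (\<Union>p\<in>P2. cball (fst p) (snd p))"
    "(\<integral>\<^sup>+p. emeasure lborel (cball (fst p) (snd p)) \<partial>count_space P2) \<le> ennreal (e / 2)"
    using negligible_cball_cover[OF P1(4) \<open>\<eta> > 0\<close>, of "e / 2"] \<open>e > 0\<close> by auto
  let ?F = "\<lambda>p. emeasure lborel (cball (fst p) (snd p))"
  show ?thesis
  proof
    show "countable (P1 \<union> P2)" using P1 P2 by simp
    show "\<And>p. p \<in> P1 \<union> P2 \<Longrightarrow> 0 < snd p \<and> snd p < \<eta>" using P1(2) P2(2) by (auto simp: K_def)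
    show "E \<subseteq> (\<Union>p\<in>P1 \<union> P2. cball (fst p) (snd p))" using P2(3) by blast
    have "(\<integral>\<^sup>+p. ?F p \<partial>count_space (P1 \<union> P2)) = (\<integral>\<^sup>+p. ?F p * indicator (P1 \<union> P2) p \<partial>count_space UNIV)"
      by (simp add: nn_integral_count_space_indicator)
    also have "\<dots> \<le> (\<integral>\<^sup>+p. ?F p * indicator P1 p + ?F p * indicator P2 p \<partial>count_space UNIV)"
      by (intro nn_integral_mono) (auto simp: indicator_def)
    also have "\<dots> = (\<integral>\<^sup>+p. ?F p \<partial>count_space P1) + (\<integral>\<^sup>+p. ?F p \<partial>count_space P2)"
      by (simp add: nn_integral_count_space_indicator nn_integral_add)
    also have "\<dots> \<le> (emeasure lborel E + ennreal (e / 2)) + ennreal (e / 2)"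
      using P1 W(1) by (intro add_mono P2(4) order_trans[OF disjoint_cballs_emeasure_le Wm]) (auto simp: K_def)
    also have "\<dots> = emeasure lborel E + ennreal e"
      using \<open>e > 0\<close> by (simp add: add.assoc flip: ennreal_plus)
    finally show "(\<integral>\<^sup>+p. ?F p \<partial>count_space (P1 \<union> P2)) \<le> emeasure lborel E + ennreal e" .
  qed
qed

text \<open>The image of a ball of radius \<open>r\<close> has diameter at most
  \<open>2 * L * r\<close>, so with the normalisation by \<open>unit_ball_vol\<close> its term is at
  most \<open>L ^ DIM('b)\<close> times the volume of the ball. Radii below
  \<open>\<delta> / (2 * L)\<close> keep the diameters admissible.\<close>

theorem hausdorff_outer_lipschitz_image_le:
  fixes s :: "'b::euclidean_space \<Rightarrow> 'a::metric_space"
  assumes E: "E \<in> sets borel" and L: "L > 0"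
    and lip: "\<And>v w. v \<in> E \<Longrightarrow> w \<in> E \<Longrightarrow> dist (s v) (s w) \<le> L * dist v w"
  shows "hausdorff_outer DIM('b) (s ` E) \<le> ennreal (L ^ DIM('b)) * emeasure lborel E"
  unfolding hausdorff_outer_def
proof (rule SUP_least)
  fix \<delta> :: real assume "\<delta> \<in> {0<..}"
  then have \<delta>: "\<delta> > 0" by simp
  let ?t = "\<lambda>A::'a set. ennreal (unit_ball_vol (real DIM('b)) * (diameter A / 2) ^ DIM('b))"
  let ?I = "INF C \<in> {C :: nat \<Rightarrow> 'a set. s ` E \<subseteq> (\<Union>i. C i) \<and> (\<forall>i. bounded (C i) \<and> diameter (C i) \<le> \<delta>)}. (\<Sum>i. ?t (C i))"
  show "?I \<le> ennreal (L ^ DIM('b)) * emeasure lborel E"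
  proof (rule ennreal_le_epsilon)
    fix e :: real assume e: "e > 0"
    obtain P :: "('b \<times> real) set" where P: "countable P" "\<And>p. p \<in> P \<Longrightarrow> 0 < snd p \<and> snd p < \<delta> / (2 * L)"
      "E \<subseteq> (\<Union>p\<in>P. cball (fst p) (snd p))"
      "(\<integral>\<^sup>+p. emeasure lborel (cball (fst p) (snd p)) \<partial>count_space P) \<le> emeasure lborel E + ennreal (e / L ^ DIM('b))"
      using fine_cball_cover[OF E, of "\<delta> / (2 * L)" "e / L ^ DIM('b)"] \<delta> L e by auto
    define A where "A p = s ` (E \<inter> cball (fst p) (snd p))" for p
    have Adist: "dist x y \<le> 2 * L * snd p" if xy: "x \<in> A p" "y \<in> A p" for x y p
    proof -
      obtain v w where vw: "v \<in> E \<inter> cball (fst p) (snd p)" "x = s v" "w \<in> E \<inter> cball (fst p) (snd p)" "y = s w"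
        using xy unfolding A_def by blast
      have "dist x y \<le> L * dist v w" using lip vw by auto
      also have "dist v w \<le> snd p + snd p"
        using vw dist_triangle2[of v w "fst p"] by (auto simp: dist_commute)
      finally show ?thesis using L by (simp add: mult_left_mono)
    qed
    have Abdd: "bounded (A p)" for p
      unfolding bounded_two_points using Adist by blast
    have Adiam: "diameter (A p) \<le> 2 * L * snd p" if "p \<in> P" for p
    proof (cases "A p = {}")
      case True then show ?thesis using P(2)[OF that] L by simp
    next
      case False
      then show ?thesis unfolding diameter_def by (auto intro!: cSUP_least Adist)
    qed
    have At: "?t (A p) \<le> ennreal (L ^ DIM('b)) * emeasure lborel (cball (fst p) (snd p))" if "p \<in> P" for p
    proof -
      have "?t (A p) \<le> ennreal (unit_ball_vol (real DIM('b)) * (L * snd p) ^ DIM('b))"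
        using Adiam[OF that] diameter_ge_0[OF Abdd, of p] by (intro ennreal_leI mult_left_mono power_mono) auto
      also have "\<dots> = ennreal (L ^ DIM('b)) * emeasure lborel (cball (fst p) (snd p))"
        using P(2)[OF that] L by (simp add: emeasure_cball power_mult_distrib mult_ac flip: ennreal_mult')
      finally show ?thesis .
    qed
    define J where "J = to_nat_on P ` P"
    have bij: "bij_betw (to_nat_on P) P J"
      using P(1) by (auto simp: J_def bij_betw_def)
    define C where "C n = (if n \<in> J then A (from_nat_into P n) else {})" for n
    have inv: "from_nat_into P (to_nat_on P p) = p" if "p \<in> P" for p
      using P(1) that by simp
    have "C \<in> {C. s ` E \<subseteq> (\<Union>i. C i) \<and> (\<forall>i. bounded (C i) \<and> diameter (C i) \<le> \<delta>)}"
    proof (intro CollectI conjI allI)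
      show "s ` E \<subseteq> (\<Union>i. C i)"
      proof clarify
        fix v assume "v \<in> E"
        then obtain p where p: "p \<in> P" "v \<in> cball (fst p) (snd p)" using P(3) by blast
        then have "s v \<in> C (to_nat_on P p)" using \<open>v \<in> E\<close> inv by (auto simp: C_def J_def A_def)
        then show "s v \<in> (\<Union>i. C i)" by blast
      qed
      fix n
      show "bounded (C n)" using Abdd by (simp add: C_def)
      show "diameter (C n) \<le> \<delta>"
      proof (cases "n \<in> J")
        case True
        then obtain p where p: "p \<in> P" "n = to_nat_on P p" by (auto simp: J_def)
        have "2 * L * snd p \<le> \<delta>" using P(2)[OF p(1)] L by (simp add: field_simps)
        then show ?thesis using Adiam[OF p(1)] True p inv by (simp add: C_def)
      qed (use \<delta> in \<open>simp add: C_def\<close>)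
    qed
    then have "?I \<le> (\<Sum>n. ?t (C n))" by (rule INF_lower)
    also have "\<dots> = (\<integral>\<^sup>+n. ?t (C n) \<partial>count_space UNIV)" by (rule nn_integral_count_space_nat[symmetric])
    also have "\<dots> = (\<integral>\<^sup>+n. ?t (A (from_nat_into P n)) * indicator J n \<partial>count_space UNIV)"
      by (intro nn_integral_cong) (simp add: C_def)
    also have "\<dots> = (\<integral>\<^sup>+n. ?t (A (from_nat_into P n)) \<partial>count_space J)"
      by (simp add: nn_integral_count_space_indicator)
    also have "\<dots> = (\<integral>\<^sup>+p. ?t (A (from_nat_into P (to_nat_on P p))) \<partial>count_space P)"
      by (rule nn_integral_bij_count_space[OF bij, symmetric])
    also have "\<dots> \<le> (\<integral>\<^sup>+p. ennreal (L ^ DIM('b)) * emeasure lborel (cball (fst p) (snd p)) \<partial>count_space P)"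
      using At inv by (intro nn_integral_mono) auto
    also have "\<dots> = ennreal (L ^ DIM('b)) * (\<integral>\<^sup>+p. emeasure lborel (cball (fst p) (snd p)) \<partial>count_space P)"
      by (rule nn_integral_cmult) simp
    also have "\<dots> \<le> ennreal (L ^ DIM('b)) * (emeasure lborel E + ennreal (e / L ^ DIM('b)))"
      by (intro mult_left_mono P(4)) simp
    also have "\<dots> = ennreal (L ^ DIM('b)) * emeasure lborel E + ennreal e"
      using L e by (simp add: distrib_left flip: ennreal_mult')
    finally show "?I \<le> ennreal (L ^ DIM('b)) * emeasure lborel E + ennreal e" .
  qed
qed

text \<open>If \<open>hausdorff_outer d\<close> were not countably additive on the Borel sets, \<open>measure_of\<close> would return the
  zero measure; so one set of nonzero measure makes the Caratheodory argument unnecessary.\<close>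

lemma emeasure_hausdorff_measure:
  fixes A B :: "'a::metric_space set"
  assumes "emeasure (hausdorff_measure d) A \<noteq> 0" and B: "B \<in> sets borel"
  shows "emeasure (hausdorff_measure d) B = hausdorff_outer d B"
proof -
  have sigma: "sigma_sets UNIV (sets borel) = sets borel"
    using sets.sigma_sets_eq[of borel] by simp
  show ?thesis
    using assms by (auto simp: hausdorff_measure_def emeasure_measure_of_conv sigma split: if_splits)
qed

lemma sets_hausdorff_measure[measurable_cong, simp]: "sets (hausdorff_measure d) = sets borel"
  using sets.sigma_sets_eq[of "borel :: 'a::metric_space measure"] by (simp add: hausdorff_measure_def)

section \<open>The Hausdorff measure in graph coordinates\<close>

text \<open>\<open>H\<close> is abstract so that the agreement of \<open>hausdorff_measure\<close>
  with its outer measure on Borel sets is settled once, at the interpretation.\<close>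

locale hausdorff_local_graph = local_graph \<Omega> x \<iota> \<pi> s \<rho> C
  for \<Omega> :: "'a::euclidean_space set" and x \<iota> and \<pi> :: "'a \<Rightarrow> 'b::euclidean_space" and s \<rho> C +
  fixes H :: "'a measure"
  assumes sets_H[measurable_cong, simp]: "sets H = sets borel"
    and emeasure_H: "B \<in> sets borel \<Longrightarrow> emeasure H B = hausdorff_outer DIM('b) B"
begin

definition "G = s ` ball 0 \<rho>"

lemma space_H: "space H = UNIV"
  using sets_eq_imp_space_eq[OF sets_H] by simp

lemma s_0: "s 0 = x"
  using s_\<pi>[OF base] radius_pos by (simp add: linear_0[OF linear_\<pi>])

lemma \<pi>_measurable[measurable]: "(\<lambda>y. \<pi> (y - x)) \<in> borel \<rightarrow>\<^sub>M borel"
  using linear_\<pi> by (intro borel_measurable_continuous_onI continuous_intros linear_continuous_on_compose[OF _ linear_\<pi>])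

lemma s_continuous: "continuous_on (ball 0 \<rho>) s"
proof -
  have "continuous (at w) s" if w: "w \<in> ball 0 \<rho>" for w
  proof -
    obtain r where r: "norm w < r" "r < \<rho>" using w dense by auto
    have r0: "r > 0" using r norm_ge_zero[of w] by linarith
    define L where "L = 1 + C * r\<^sup>2"
    have L: "L > 0" using C_nonneg by (auto simp: L_def add_pos_nonneg)
    have "continuous_on (cball 0 r) s"
    proof (rule continuous_onI)
      fix v :: 'b and e :: real assume v: "v \<in> cball 0 r" and e: "e > 0"
      have "dist (s u) (s v) \<le> e" if "u \<in> cball 0 r" "dist u v < e / L" for u
      proof -
        have "dist (s u) (s v) \<le> L * dist u v"
          using s_lipschitz[OF r(2) that(1) v] by (simp add: L_def dist_norm)
        also have "\<dots> \<le> L * (e / L)" using that L by (intro mult_left_mono) auto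
        finally show ?thesis using L by simp
      qed
      then show "\<exists>d>0. \<forall>u\<in>cball 0 r. dist u v < d \<longrightarrow> dist (s u) (s v) \<le> e"
        using e L by (intro exI[of _ "e / L"]) auto
    qed
    then have "continuous_on (ball 0 r) s" by (rule continuous_on_subset) auto
    then show ?thesis using r by (simp add: continuous_on_eq_continuous_at)
  qed
  then show ?thesis by (simp add: continuous_at_imp_continuous_on)
qed

text \<open>A continuous image of an open ball need not be Borel in general; here it is a countable
  union of images of closed balls, which are compact.\<close>

lemma G_borel[measurable]: "G \<in> sets borel"
proof -
  define K where "K n = s ` cball 0 (\<rho> - \<rho> / real (Suc n))" for n
  have sub: "cball 0 (\<rho> - \<rho> / real (Suc n)) \<subseteq> ball (0::'b) \<rho>" for n
  proof -
    have "\<rho> - \<rho> / real (Suc n) < \<rho>" using radius_pos by simp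
    then show ?thesis by auto
  qed
  have "compact (K n)" for n
    unfolding K_def by (intro compact_continuous_image continuous_on_subset[OF s_continuous sub]) simp
  then have "(\<Union>n. K n) \<in> sets borel" by (intro sets.countable_UN) (auto intro: borel_compact)
  also have "(\<Union>n. K n) = G"
  proof
    show "(\<Union>n. K n) \<subseteq> G" using sub unfolding K_def G_def by blast
    show "G \<subseteq> (\<Union>n. K n)"
    proof
      fix y assume "y \<in> G"
      then obtain w where w: "w \<in> ball 0 \<rho>" "y = s w" by (auto simp: G_def)
      then have pos: "0 < \<rho> - norm w" by simp
      obtain n where n: "\<rho> / (\<rho> - norm w) < real n" using reals_Archimedean2 by blast
      then have "\<rho> < real n * (\<rho> - norm w)" using pos by (simp add: field_simps)
      also have "\<dots> \<le> real (Suc n) * (\<rho> - norm w)" using pos by (intro mult_right_mono) auto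
      finally have "\<rho> / real (Suc n) < \<rho> - norm w" by (simp add: field_simps)
      then have "w \<in> cball 0 (\<rho> - \<rho> / real (Suc n))" by simp
      then show "y \<in> (\<Union>n. K n)" using w unfolding K_def by blast
    qed
  qed
  finally show ?thesis .
qed

section \<open>Transport of the Hausdorff measure to the tangent space\<close>

lemma s_image_eq: "s ` (B \<inter> ball 0 \<rho>) = G \<inter> (\<lambda>y. \<pi> (y - x)) -` B"
  using \<pi>_s by (force simp: G_def)

text \<open>A pull-back along \<open>s\<close>, written as a push-forward along the projection: that
  map is defined and Borel everywhere and inverts \<open>s\<close> on \<open>G\<close>.\<close>

definition pullback :: "'b measure" where
  "pullback = distr (density H (indicator G)) borel (\<lambda>y. \<pi> (y - x))"

lemma sets_pullback[measurable_cong, simp]: "sets pullback = sets borel"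
  by (simp add: pullback_def)

lemma emeasure_pullback:
  assumes [measurable]: "B \<in> sets borel"
  shows "emeasure pullback B = hausdorff_outer DIM('b) (s ` (B \<inter> ball 0 \<rho>))"
proof -
  have V: "(\<lambda>y. \<pi> (y - x)) -` B \<in> sets borel"
    using measurable_sets[OF \<pi>_measurable assms] by simp
  have "emeasure pullback B = emeasure (density H (indicator G)) ((\<lambda>y. \<pi> (y - x)) -` B)"
    unfolding pullback_def by (subst emeasure_distr) (auto simp: space_H)
  also have "\<dots> = emeasure H (G \<inter> (\<lambda>y. \<pi> (y - x)) -` B)"
    using V by (subst emeasure_density) (auto simp flip: indicator_inter_arith)
  also have "\<dots> = hausdorff_outer DIM('b) (G \<inter> (\<lambda>y. \<pi> (y - x)) -` B)"
    using V by (intro emeasure_H) auto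
  finally show ?thesis by (simp add: s_image_eq)
qed

text \<open>The lower bound comes from the projection, a contraction taking the image of
  \<open>B\<close> under \<open>s\<close> back onto \<open>B\<close>, and therefore carries no error
  factor. The upper bound comes from the Lipschitz constant of \<open>s\<close> on the ball of
  radius \<open>r\<close>.\<close>

lemma pullback_bounds:
  assumes B[measurable]: "B \<in> sets borel" and sub: "B \<subseteq> cball 0 r" and r: "r < \<rho>"
  shows "emeasure lborel B \<le> emeasure pullback B"
    and "emeasure pullback B \<le> ennreal ((1 + C * r\<^sup>2) ^ DIM('b)) * emeasure lborel B"
proof -
  have B\<rho>: "B \<inter> ball 0 \<rho> = B" using sub r by force
  have B_ball: "w \<in> ball 0 \<rho>" if "w \<in> B" for w using that B\<rho> by blast
  have "emeasure lborel B \<le> hausdorff_outer DIM('b) (s ` B)"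
  proof (rule lborel_le_hausdorff_outer)
    show "dist (\<pi> (y - x)) (\<pi> (z - x)) \<le> dist y z" for y z
      using norm_\<pi>_le[of "y - z"] by (simp add: dist_norm flip: linear_diff[OF linear_\<pi>])
    show "B \<subseteq> (\<lambda>y. \<pi> (y - x)) ` s ` B" using \<pi>_s B_ball by (force simp: image_iff)
  qed
  then show "emeasure lborel B \<le> emeasure pullback B" by (simp add: emeasure_pullback B\<rho>)
  have "hausdorff_outer DIM('b) (s ` B) \<le> ennreal ((1 + C * r\<^sup>2) ^ DIM('b)) * emeasure lborel B"
  proof (rule hausdorff_outer_lipschitz_image_le)
    show "1 + C * r\<^sup>2 > 0" using C_nonneg by (auto simp: add_pos_nonneg)
    show "dist (s v) (s w) \<le> (1 + C * r\<^sup>2) * dist v w" if "v \<in> B" "w \<in> B" for v w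
      using s_lipschitz[OF r subsetD[OF sub that(1)] subsetD[OF sub that(2)]] by (simp add: dist_norm)
  qed fact
  then show "emeasure pullback B \<le> ennreal ((1 + C * r\<^sup>2) ^ DIM('b)) * emeasure lborel B"
    by (simp add: emeasure_pullback B\<rho>)
qed

text \<open>The set bounds hold only inside \<open>cball 0 r\<close>; restricting both measures to
  that ball turns them into inequalities of measures, which can be integrated.\<close>

lemma nn_integral_pullback_bounds:
  assumes f[measurable]: "f \<in> borel_measurable borel" and supp: "\<And>w. w \<notin> cball 0 r \<Longrightarrow> f w = 0" and r: "r < \<rho>"
  shows "(\<integral>\<^sup>+w. f w \<partial>lborel) \<le> (\<integral>\<^sup>+w. f w \<partial>pullback)"
    and "(\<integral>\<^sup>+w. f w \<partial>pullback) \<le> ennreal ((1 + C * r\<^sup>2) ^ DIM('b)) * (\<integral>\<^sup>+w. f w \<partial>lborel)"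
proof -
  let ?c = "ennreal ((1 + C * r\<^sup>2) ^ DIM('b))"
  let ?i = "indicator (cball 0 r) :: 'b \<Rightarrow> ennreal"
  let ?L = "density lborel ?i" and ?P = "density pullback ?i"
  have [measurable]: "f \<in> borel_measurable pullback" by measurable
  have [measurable]: "?i \<in> borel_measurable borel" by (rule borel_measurable_indicator) simp
  have fi: "?i w * f w = f w" for w using supp by (cases "w \<in> cball 0 r") auto
  have L: "(\<integral>\<^sup>+w. f w \<partial>?L) = (\<integral>\<^sup>+w. f w \<partial>lborel)"
    by (subst nn_integral_density) (auto simp: fi)
  have P: "(\<integral>\<^sup>+w. f w \<partial>?P) = (\<integral>\<^sup>+w. f w \<partial>pullback)"
    by (subst nn_integral_density) (auto simp: fi)
  have eL: "emeasure ?L A = emeasure lborel (A \<inter> cball 0 r)" and eP: "emeasure ?P A = emeasure pullback (A \<inter> cball 0 r)"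
    if "A \<in> sets borel" for A
    using that by (auto simp: emeasure_density indicator_inter_arith[symmetric] Int_commute)
  have le1: "?L \<le> ?P"
    by (subst le_measure) (auto simp: eL eP intro!: pullback_bounds(1)[OF _ _ r])
  have le2: "?P \<le> scale_measure ?c ?L"
    by (subst le_measure) (auto simp: eL eP intro!: pullback_bounds(2)[OF _ _ r])
  show "(\<integral>\<^sup>+w. f w \<partial>lborel) \<le> (\<integral>\<^sup>+w. f w \<partial>pullback)"
    using nn_integral_mono_measure[OF _ le1, of f] by (simp add: L P)
  show "(\<integral>\<^sup>+w. f w \<partial>pullback) \<le> ?c * (\<integral>\<^sup>+w. f w \<partial>lborel)"
    using nn_integral_mono_measure[OF _ le2, of f] by (simp add: L P nn_integral_scale_measure)
qed

lemma integral_pullback_nonneg: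
  fixes f :: "'b \<Rightarrow> real"
  assumes f[measurable]: "f \<in> borel_measurable borel" and supp: "\<And>w. w \<notin> cball 0 r \<Longrightarrow> f w = 0" and r: "0 \<le> r" "r < \<rho>"
    and bdd: "\<And>w. 0 \<le> f w" "\<And>w. f w \<le> B"
  shows "integrable pullback f" and "integral\<^sup>L lborel f \<le> integral\<^sup>L pullback f"
    and "integral\<^sup>L pullback f \<le> (1 + C * r\<^sup>2) ^ DIM('b) * integral\<^sup>L lborel f"
proof -
  let ?c = "(1 + C * r\<^sup>2) ^ DIM('b)"
  have c0: "?c \<ge> 0" using C_nonneg by simp
  have B0: "B \<ge> 0" using bdd[of 0] by linarith
  have nn: "(\<integral>\<^sup>+w. ennreal (f w) \<partial>lborel) \<le> (\<integral>\<^sup>+w. ennreal (f w) \<partial>pullback)"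
    "(\<integral>\<^sup>+w. ennreal (f w) \<partial>pullback) \<le> ennreal ?c * (\<integral>\<^sup>+w. ennreal (f w) \<partial>lborel)"
    by (rule nn_integral_pullback_bounds[OF _ _ r(2)]; simp add: supp)+
  have "(\<integral>\<^sup>+w. ennreal (f w) \<partial>lborel) \<le> (\<integral>\<^sup>+w. ennreal B * indicator (cball (0::'b) r) w \<partial>lborel)"
    using supp bdd by (intro nn_integral_mono) (auto simp: indicator_def ennreal_leI)
  also have "\<dots> = ennreal B * emeasure lborel (cball (0::'b) r)"
    by (rule nn_integral_cmult_indicator) simp
  also have "\<dots> < \<top>" using r by (simp add: emeasure_cball ennreal_mult_less_top)
  finally have fin: "(\<integral>\<^sup>+w. ennreal (f w) \<partial>lborel) < \<top>" .
  have intL: "integrable lborel f" using fin bdd by (intro integrableI_nonneg) auto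
  note nn(2)
  also have "ennreal ?c * (\<integral>\<^sup>+w. ennreal (f w) \<partial>lborel) < \<top>"
    using fin by (simp add: ennreal_mult_less_top)
  finally have "(\<integral>\<^sup>+w. ennreal (f w) \<partial>pullback) < \<top>" .
  then show intP: "integrable pullback f" using bdd by (intro integrableI_nonneg) auto
  have eq: "(\<integral>\<^sup>+w. ennreal (f w) \<partial>lborel) = ennreal (integral\<^sup>L lborel f)"
    "(\<integral>\<^sup>+w. ennreal (f w) \<partial>pullback) = ennreal (integral\<^sup>L pullback f)"
    using bdd by (intro nn_integral_eq_integral intL intP AE_I2; simp)+
  have pos: "0 \<le> integral\<^sup>L lborel f" "0 \<le> integral\<^sup>L pullback f" using bdd by (simp_all add: integral_nonneg)
  show "integral\<^sup>L lborel f \<le> integral\<^sup>L pullback f" using nn(1) pos by (simp add: eq)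
  show "integral\<^sup>L pullback f \<le> ?c * integral\<^sup>L lborel f" using nn(2) pos c0 by (simp add: eq flip: ennreal_mult)
qed

end

section \<open>Moments of the kernel\<close>

lemma lborel_integral_scaleR:
  fixes f :: "'b::euclidean_space \<Rightarrow> real"
  assumes [measurable]: "f \<in> borel_measurable borel" and h: "h \<noteq> 0"
  shows "integral\<^sup>L lborel f = \<bar>h\<bar> ^ DIM('b) * (\<integral>u. f (h *\<^sub>R u) \<partial>lborel)"
proof -
  have "integral\<^sup>L lborel f = integral\<^sup>L (density (distr lborel borel (\<lambda>x. 0 + h *\<^sub>R x)) (\<lambda>_. ennreal (\<bar>h\<bar> ^ DIM('b)))) f"
    using lborel_affine[OF h, of "0::'b"] by simp
  also have "\<dots> = (\<integral>x. \<bar>h\<bar> ^ DIM('b) *\<^sub>R f x \<partial>distr lborel borel (\<lambda>x. 0 + h *\<^sub>R x))"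
    by (rule integral_density) auto
  also have "\<dots> = (\<integral>u. \<bar>h\<bar> ^ DIM('b) *\<^sub>R f (h *\<^sub>R u) \<partial>lborel)"
    by (subst integral_distr) auto
  finally show ?thesis by simp
qed

lemma lborel_integral_cball_bound:
  fixes f :: "'b::euclidean_space \<Rightarrow> real"
  assumes [measurable]: "f \<in> borel_measurable borel" and supp: "\<And>w. w \<notin> cball 0 r \<Longrightarrow> f w = 0"
    and bdd: "\<And>w. w \<in> cball 0 r \<Longrightarrow> \<bar>f w\<bar> \<le> B" and r: "r \<ge> 0"
  shows "integrable lborel f" and "\<bar>integral\<^sup>L lborel f\<bar> \<le> B * (unit_ball_vol (real DIM('b)) * r ^ DIM('b))"
proof -
  have int: "integrable lborel (\<lambda>w::'b. B * indicator (cball 0 r) w)"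
    using r by (intro integrable_mult_right integrable_real_indicator) (auto simp: emeasure_cball)
  have le: "\<bar>f w\<bar> \<le> B * indicator (cball 0 r) w" for w
    using supp bdd by (cases "w \<in> cball 0 r") auto
  show f: "integrable lborel f"
    by (rule Bochner_Integration.integrable_bound[OF int]) (use le in \<open>auto intro: order_trans[OF _ abs_ge_self]\<close>)
  have "\<bar>integral\<^sup>L lborel f\<bar> \<le> (\<integral>w. \<bar>f w\<bar> \<partial>lborel)" by (rule integral_abs_bound)
  also have "\<dots> \<le> (\<integral>w. B * indicator (cball (0::'b) r) w \<partial>lborel)"
    using f int le by (intro integral_mono) auto
  also have "\<dots> = B * (unit_ball_vol (real DIM('b)) * r ^ DIM('b))"
    using r by (simp add: content_cball)
  finally show "\<bar>integral\<^sup>L lborel f\<bar> \<le> B * (unit_ball_vol (real DIM('b)) * r ^ DIM('b))" .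
qed

text \<open>Turns the distortion \<open>(1 + C * h^2) ^ d - 1\<close> into a multiple of
  \<open>h^2\<close> whose constant is uniform in \<open>h\<close>, by summing the geometric
  series.\<close>

lemma power_minus_one_le:
  fixes u U :: real
  assumes "0 \<le> u" "u \<le> U"
  shows "(1 + u) ^ n - 1 \<le> real n * (1 + U) ^ n * u"
proof -
  have "(1 + u) ^ n - 1 = u * (\<Sum>i<n. (1 + u) ^ i)"
    using power_diff_1_eq[of "1 + u" n] by simp
  also have "\<dots> \<le> u * (\<Sum>i<n. (1 + U) ^ n)"
  proof (intro mult_left_mono sum_mono)
    fix i assume "i \<in> {..<n}"
    then have "(1 + u) ^ i \<le> (1 + u) ^ n" using assms by (intro power_increasing) auto
    also have "\<dots> \<le> (1 + U) ^ n" using assms by (intro power_mono) auto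
    finally show "(1 + u) ^ i \<le> (1 + U) ^ n" .
  qed (use assms in auto)
  finally show ?thesis by (simp add: mult_ac)
qed

section \<open>Kernel integrals in tangent coordinates\<close>

context hausdorff_local_graph
begin

lemma borel_measurable_comp_s:
  assumes [measurable]: "f \<in> borel_measurable borel"
  shows "(\<lambda>w. indicator (ball 0 \<rho>) w * (f (s w) :: real)) \<in> borel_measurable borel"
proof -
  \<comment> \<open>\<open>s\<close> is controlled only on the ball, so measurability goes through
    this globally Borel modification, which vanishes outside.\<close>
  define t where "t w = indicator (ball 0 \<rho>) w *\<^sub>R s w" for w
  have [measurable]: "t \<in> borel_measurable borel"
    unfolding t_def[abs_def] by (rule borel_measurable_continuous_on_indicator[OF _ s_continuous]) simp
  have [measurable]: "ball (0::'b) \<rho> \<in> sets borel" by simp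
  have "(\<lambda>w. indicator (ball 0 \<rho>) w * f (t w)) \<in> borel_measurable borel" by measurable
  also have "(\<lambda>w. indicator (ball 0 \<rho>) w * f (t w)) = (\<lambda>w. indicator (ball 0 \<rho>) w * f (s w))"
    by (auto simp: t_def indicator_def)
  finally show ?thesis .
qed

text \<open>A point of \<open>\<Omega>\<close> within \<open>\<rho>\<close> of \<open>x\<close>
  projects into \<open>ball 0 \<rho>\<close> and is recovered there by \<open>s\<close>, so it lies
  in \<open>G\<close>. Off \<open>G\<close> the integrand vanishes, and restricting \<open>H\<close>
  to \<open>G\<close> loses nothing.\<close>

lemma integral_eq_pullback:
  fixes f :: "'a \<Rightarrow> real"
  assumes f[measurable]: "f \<in> borel_measurable borel" and supp: "\<And>y. y \<notin> \<Omega> \<inter> ball x \<rho> \<Longrightarrow> f y = 0"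
  shows "integral\<^sup>L H f = (\<integral>w. indicator (ball 0 \<rho>) w * f (s w) \<partial>pullback)"
proof -
  note [measurable] = borel_measurable_comp_s[OF f]
  let ?h = "\<lambda>w. indicator (ball 0 \<rho>) w * f (s w)"
  have "integral\<^sup>L pullback ?h = (\<integral>y. ?h (\<pi> (y - x)) \<partial>density H (indicator G))"
    unfolding pullback_def by (rule integral_distr) auto
  also have "\<dots> = (\<integral>y. ?h (\<pi> (y - x)) \<partial>density H (\<lambda>y. ennreal (indicator G y)))"
    by (simp add: ennreal_indicator)
  also have "\<dots> = (\<integral>y. indicator G y *\<^sub>R ?h (\<pi> (y - x)) \<partial>H)"
    by (rule integral_density) auto
  also have "\<dots> = integral\<^sup>L H f"
  proof (rule Bochner_Integration.integral_cong[OF refl])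
    fix y
    show "indicator G y *\<^sub>R ?h (\<pi> (y - x)) = f y"
    proof (cases "y \<in> G")
      case True
      then obtain w where "w \<in> ball 0 \<rho>" "y = s w" by (auto simp: G_def)
      then show ?thesis using True \<pi>_s by simp
    next
      case False
      have "y \<notin> \<Omega> \<inter> ball x \<rho>"
      proof
        assume y: "y \<in> \<Omega> \<inter> ball x \<rho>"
        then have "\<pi> (y - x) \<in> ball 0 \<rho>"
          using norm_\<pi>_le[of "y - x"] by (simp add: dist_norm norm_minus_commute)
        moreover have "y = s (\<pi> (y - x))" using s_\<pi> y by simp
        ultimately show False using False unfolding G_def by blast
      qed
      then show ?thesis using supp False by simp
    qed
  qed
  finally show ?thesis by simp
qed

text \<open>The measure bounds are one-sided inequalities for nonnegative functions, hence the split
  into positive and negative part. Each part changes by an amount between \<open>0\<close> and the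
  same bound, so their difference obeys that bound without a factor 2.\<close>

lemma integral_pullback_diff:
  fixes f :: "'b \<Rightarrow> real"
  assumes f[measurable]: "f \<in> borel_measurable borel" and supp: "\<And>w. w \<notin> cball 0 r \<Longrightarrow> f w = 0" and r: "0 \<le> r" "r < \<rho>"
    and bdd: "\<And>w. \<bar>f w\<bar> \<le> B"
  shows "\<bar>integral\<^sup>L pullback f - integral\<^sup>L lborel f\<bar>
    \<le> ((1 + C * r\<^sup>2) ^ DIM('b) - 1) * (B * (unit_ball_vol (real DIM('b)) * r ^ DIM('b)))"
proof -
  let ?c = "(1 + C * r\<^sup>2) ^ DIM('b)" and ?b = "B * (unit_ball_vol (real DIM('b)) * r ^ DIM('b))"
  have c: "?c \<ge> 1" using C_nonneg by simp
  have B0: "B \<ge> 0" using bdd[of 0] by linarith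
  have part: "integrable pullback g \<and> integrable lborel g \<and> 0 \<le> integral\<^sup>L pullback g - integral\<^sup>L lborel g \<and>
      integral\<^sup>L pullback g - integral\<^sup>L lborel g \<le> (?c - 1) * ?b"
    if [measurable]: "g \<in> borel_measurable borel" and g: "\<And>w. w \<notin> cball 0 r \<Longrightarrow> g w = 0" "\<And>w. 0 \<le> g w" "\<And>w. g w \<le> B" for g
  proof -
    have P: "integrable pullback g" "integral\<^sup>L lborel g \<le> integral\<^sup>L pullback g" "integral\<^sup>L pullback g \<le> ?c * integral\<^sup>L lborel g"
      by (rule integral_pullback_nonneg[of g r B]; use g r in simp)+
    have L: "integrable lborel g" "\<bar>integral\<^sup>L lborel g\<bar> \<le> ?b"
      by (rule lborel_integral_cball_bound[of g r B]; use g r in simp)+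
    have "integral\<^sup>L pullback g - integral\<^sup>L lborel g \<le> (?c - 1) * integral\<^sup>L lborel g"
      using P by (simp add: algebra_simps)
    also have "\<dots> \<le> (?c - 1) * ?b" using L c by (intro mult_left_mono) auto
    finally show ?thesis using P L by simp
  qed
  let ?p = "\<lambda>w. max (f w) 0" and ?n = "\<lambda>w. max (- f w) 0"
  have p: "integrable pullback ?p \<and> integrable lborel ?p \<and> 0 \<le> integral\<^sup>L pullback ?p - integral\<^sup>L lborel ?p \<and>
      integral\<^sup>L pullback ?p - integral\<^sup>L lborel ?p \<le> (?c - 1) * ?b"
    using supp bdd B0 by (intro part) (auto simp: abs_le_iff)
  have n: "integrable pullback ?n \<and> integrable lborel ?n \<and> 0 \<le> integral\<^sup>L pullback ?n - integral\<^sup>L lborel ?n \<and>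
      integral\<^sup>L pullback ?n - integral\<^sup>L lborel ?n \<le> (?c - 1) * ?b"
    using supp bdd B0 by (intro part) (auto simp: abs_le_iff minus_le_iff)
  have f_eq: "f = (\<lambda>w. ?p w - ?n w)" by (auto simp: max_def)
  have "integral\<^sup>L pullback f = integral\<^sup>L pullback ?p - integral\<^sup>L pullback ?n"
    by (subst f_eq) (use p n in \<open>intro Bochner_Integration.integral_diff; simp\<close>)
  moreover have "integral\<^sup>L lborel f = integral\<^sup>L lborel ?p - integral\<^sup>L lborel ?n"
    by (subst f_eq) (use p n in \<open>intro Bochner_Integration.integral_diff; simp\<close>)
  ultimately show ?thesis using p n by (simp add: abs_le_iff)
qed

text \<open>In tangent coordinates the integrand \<open>F\<close> is compared with the model
  \<open>F0\<close>, a Euclidean radial kernel times an affine function. Changing the measure,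
  replacing \<open>norm (s w - x)\<close> by \<open>norm w\<close> inside the kernel, and expanding
  the density each cost \<open>O(h^2)\<close> relative to the volume scale
  \<open>h ^ DIM('b)\<close>; the model integral is exactly
  \<open>q x * h ^ DIM('b)\<close>.\<close>

lemma kernel_moments:
  fixes K :: "real \<Rightarrow> real" and q g :: "'a \<Rightarrow> real"
  assumes q[measurable]: "q \<in> borel_measurable borel" and q_supp: "\<And>y. y \<notin> \<Omega> \<Longrightarrow> q y = 0" and q_nonneg: "\<And>y. 0 \<le> q y"
    and g: "Ck_on 2 g U" "x \<in> U" "\<And>y. y \<in> U \<inter> \<Omega> \<Longrightarrow> q y = g y"
    and K_lip: "\<And>a b. 0 \<le> a \<Longrightarrow> 0 \<le> b \<Longrightarrow> \<bar>K a - K b\<bar> \<le> L * \<bar>a - b\<bar>" and L: "L \<ge> 0"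
    and K_supp: "\<And>t. t \<ge> 1 \<Longrightarrow> K t = 0"
    and K_int: "(\<integral>u. K (norm (u::'b)) \<partial>lborel) = 1"
  obtains h1 C6 C7 where "h1 > 0" "C6 \<ge> 0" "C7 \<ge> 0"
    "\<forall>h. 0 < h \<and> h \<le> h1 \<longrightarrow>
       \<bar>(\<integral>y. K (norm (y - x) / h) * q y \<partial>H) - q x * h ^ DIM('b)\<bar> \<le> C6 * h ^ (DIM('b) + 2) \<and>
       (\<integral>y. (K (norm (y - x) / h))\<^sup>2 * q y \<partial>H) \<le> C7 * h ^ DIM('b)"
proof -
  let ?V = "unit_ball_vol (real DIM('b))"
  have V: "?V \<ge> 0" by simp
  have K_bdd: "\<bar>K t\<bar> \<le> L" if "t \<ge> 0" for t
  proof (cases "t \<le> 1")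
    case True
    then show ?thesis using K_lip[of t 1] K_supp[of 1] that mult_left_mono[of "\<bar>t - 1\<bar>" 1 L] L by auto
  qed (use K_supp L in auto)
  have K_cont: "continuous_on {0..} K"
  proof (rule continuous_onI)
    fix t e :: real assume t: "t \<in> {0..}" and e: "e > 0"
    have "dist (K u) (K t) \<le> e" if "u \<in> {0..}" "dist u t < e / (L + 1)" for u
    proof -
      have "\<bar>K u - K t\<bar> \<le> L * \<bar>u - t\<bar>" using K_lip t that by auto
      also have "\<dots> \<le> (L + 1) * (e / (L + 1))" using that L e by (intro mult_mono) (auto simp: dist_real_def)
      finally show ?thesis using L by (simp add: dist_real_def)
    qed
    then show "\<exists>d>0. \<forall>u\<in>{0..}. dist u t < d \<longrightarrow> dist (K u) (K t) \<le> e"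
      using e L by (intro exI[of _ "e / (L + 1)"]) auto
  qed
  have K_meas_b[measurable]: "(\<lambda>w::'b. K (norm w / h)) \<in> borel_measurable borel" if "h > 0" for h
    using that by (intro borel_measurable_continuous_onI continuous_on_compose2[OF K_cont] continuous_intros) auto
  have K_meas_a[measurable]: "(\<lambda>y::'a. K (norm (y - x) / h)) \<in> borel_measurable borel" if "h > 0" for h
    using that by (intro borel_measurable_continuous_onI continuous_on_compose2[OF K_cont] continuous_intros) auto
  define A where "A v = (\<Sum>b\<in>Basis. (v \<bullet> b) *\<^sub>R partial_dir g b x)" for v
  have linA: "linear A"
    unfolding A_def[abs_def] by (rule linearI) (simp_all add: inner_add_left distrib_right sum.distrib sum_distrib_left mult.assoc)
  obtain Cg \<rho>g where Cg: "Cg \<ge> 0" "\<rho>g > 0" "cball x \<rho>g \<subseteq> U"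
    and strict: "\<And>r y z. r \<le> \<rho>g \<Longrightarrow> y \<in> cball x r \<Longrightarrow> z \<in> cball x r \<Longrightarrow> norm (g y - g z - A (y - z)) \<le> Cg * r * norm (y - z)"
    using C2_strict_differentiability[OF g(1,2)] unfolding A_def by metis
  obtain NA where NA: "NA > 0" "\<And>v. norm (A v) \<le> NA * norm v"
    using linear_bounded_pos[OF linA] by metis
  \<comment> \<open>A bound for the Lipschitz constants of \<open>s\<close> on all balls of radius
    below \<open>\<rho>\<close>, so that later constants do not depend on \<open>h\<close>.\<close>
  define \<kappa> where "\<kappa> = 1 + C * \<rho>\<^sup>2"
  have \<kappa>: "\<kappa> \<ge> 1" using C_nonneg by (simp add: \<kappa>_def)
  have s_upper: "norm (s w - x) \<le> (1 + C * (norm w)\<^sup>2) * norm w" if "w \<in> ball 0 \<rho>" for w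
    using s_lipschitz[of "norm w" w 0] that by (simp add: s_0)
  have s_upper': "norm (s w - x) \<le> \<kappa> * norm w" if "w \<in> ball 0 \<rho>" for w
  proof -
    have "(norm w)\<^sup>2 \<le> \<rho>\<^sup>2" using that by (intro power_mono) auto
    then have "1 + C * (norm w)\<^sup>2 \<le> \<kappa>" using C_nonneg by (simp add: \<kappa>_def mult_left_mono)
    then show ?thesis using s_upper[OF that] mult_right_mono[of "1 + C * (norm w)\<^sup>2" \<kappa> "norm w"] by simp
  qed
  have s_lower: "norm w \<le> norm (s w - x)" if "w \<in> ball 0 \<rho>" for w
    using norm_\<pi>_le[of "s w - x"] \<pi>_s[OF that] by simp
  \<comment> \<open>The first entry stays strictly inside the graph's domain; the second makes
    \<open>s w\<close> land in the ball around \<open>x\<close> where the expansion of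
    \<open>g\<close> is valid.\<close>
  define h1 where "h1 = min (\<rho> / 2) (\<rho>g / \<kappa>)"
  have h1: "h1 > 0" "h1 < \<rho>" "\<kappa> * h1 \<le> \<rho>g"
  proof -
    show "h1 > 0" "h1 < \<rho>" using radius_pos Cg \<kappa> by (auto simp: h1_def)
    have "\<kappa> * h1 \<le> \<kappa> * (\<rho>g / \<kappa>)" using \<kappa> by (intro mult_left_mono) (auto simp: h1_def)
    then show "\<kappa> * h1 \<le> \<rho>g" using \<kappa> by simp
  qed
  \<comment> \<open>First the remainder of \<open>g\<close> at \<open>s w\<close>, with
    \<open>norm (s w - x) \<le> \<kappa> * norm w\<close>; then the cost of replacing
    \<open>s w - x\<close> by its tangent \<open>\<iota> w\<close> in the linear term.\<close>
  define Cq where "Cq = Cg * \<kappa>\<^sup>2 + NA * C"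
  have Cq: "Cq \<ge> 0" using Cg NA C_nonneg by (simp add: Cq_def)
  have q_taylor: "\<bar>q (s w) - (q x + A (\<iota> w))\<bar> \<le> Cq * (norm w)\<^sup>2" if w: "norm w \<le> h1" for w
  proof -
    have wb: "w \<in> ball 0 \<rho>" using w h1 by simp
    let ?y = "s w"
    have yr: "norm (?y - x) \<le> \<rho>g"
      using s_upper'[OF wb] mult_left_mono[OF w, of \<kappa>] \<kappa> h1 by linarith
    then have yU: "?y \<in> U" using Cg(3) by (auto simp: dist_norm norm_minus_commute subset_iff)
    have qy: "q ?y = g ?y" "q x = g x" using g yU base s_mem[OF wb] by auto
    have "norm (g ?y - g x - A (?y - x)) \<le> Cg * norm (?y - x) * norm (?y - x)"
      using yr by (intro strict) (auto simp: dist_norm norm_minus_commute)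
    also have "\<dots> \<le> Cg * (\<kappa> * norm w) * (\<kappa> * norm w)"
      using s_upper'[OF wb] Cg \<kappa> by (intro mult_mono) auto
    finally have 1: "\<bar>g ?y - g x - A (?y - x)\<bar> \<le> Cg * \<kappa>\<^sup>2 * (norm w)\<^sup>2" by (simp add: power2_eq_square mult_ac)
    have "norm (A (?y - x - \<iota> w)) \<le> NA * norm (?y - x - \<iota> w)" by (rule NA)
    also have "\<dots> \<le> NA * (C * (norm w)\<^sup>2)" using NA s_tangent[OF wb] by (intro mult_left_mono) auto
    finally have 2: "\<bar>A (?y - x) - A (\<iota> w)\<bar> \<le> NA * C * (norm w)\<^sup>2" by (simp add: linear_diff[OF linA])
    have "\<bar>q ?y - (q x + A (\<iota> w))\<bar> \<le> \<bar>g ?y - g x - A (?y - x)\<bar> + \<bar>A (?y - x) - A (\<iota> w)\<bar>" using qy by linarith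
    also have "\<dots> \<le> Cq * (norm w)\<^sup>2" using 1 2 by (simp add: Cq_def distrib_right)
    finally show ?thesis .
  qed
  define Q where "Q = \<bar>q x\<bar> + NA * \<rho> + Cq * \<rho>\<^sup>2"
  have Q: "Q \<ge> 0" using NA radius_pos Cq by (simp add: Q_def)
  have A\<iota>: "\<bar>A (\<iota> w)\<bar> \<le> NA * norm w" for w using NA(2)[of "\<iota> w"] by (simp add: norm_\<iota>)
  have q_bdd: "\<bar>q (s w)\<bar> \<le> Q" if w: "norm w \<le> h1" for w
  proof -
    have "norm w \<le> \<rho>" using w h1 by simp
    then have "NA * norm w \<le> NA * \<rho>" "Cq * (norm w)\<^sup>2 \<le> Cq * \<rho>\<^sup>2"
      using NA Cq by (auto intro!: mult_left_mono power_mono)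
    then show ?thesis using q_taylor[OF w] A\<iota>[of w] unfolding Q_def by linarith
  qed
  \<comment> \<open>The first summand accounts for the error in the kernel's argument, the second
    for the Taylor error of the density.\<close>
  define C5 where "C5 = L * C * Q + L * Cq"
  have C5: "C5 \<ge> 0" using L C_nonneg Q Cq by (simp add: C5_def)
  \<comment> \<open>The constant of \<open>power_minus_one_le\<close> with
    \<open>U = C * \<rho>^2\<close>, for which \<open>1 + U\<close> is
    \<open>\<kappa>\<close>.\<close>
  define C' where "C' = real DIM('b) * \<kappa> ^ DIM('b) * C"
  have C': "C' \<ge> 0" using \<kappa> C_nonneg by (simp add: C'_def)
  show ?thesis
  proof (rule that)
    show "h1 > 0" by (rule h1)
    show "(C' * (L * Q) + C5) * ?V \<ge> 0" using C' L Q C5 V by simp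
    show "\<kappa> ^ DIM('b) * (L\<^sup>2 * Q * ?V) \<ge> 0" using \<kappa> L Q V by simp
    show "\<forall>h. 0 < h \<and> h \<le> h1 \<longrightarrow>
       \<bar>(\<integral>y. K (norm (y - x) / h) * q y \<partial>H) - q x * h ^ DIM('b)\<bar> \<le> (C' * (L * Q) + C5) * ?V * h ^ (DIM('b) + 2) \<and>
       (\<integral>y. (K (norm (y - x) / h))\<^sup>2 * q y \<partial>H) \<le> \<kappa> ^ DIM('b) * (L\<^sup>2 * Q * ?V) * h ^ DIM('b)"
    proof (intro allI impI conjI)
      fix h assume "0 < h \<and> h \<le> h1"
      then have h: "0 < h" "h \<le> h1" by auto
      note [measurable] = K_meas_a[OF h(1)] K_meas_b[OF h(1)]
      have h\<rho>: "h < \<rho>" using h h1 by simp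
      have Kz: "K (norm (y - x) / h) = 0" if "y \<notin> ball x h" for y
        using that h by (intro K_supp) (auto simp: dist_norm norm_minus_commute)
      \<comment> \<open>Projection does not increase distances, so the support is not enlarged by
        passing to tangent coordinates.\<close>
      have Ks: "K (norm (s w - x) / h) = 0" if "w \<in> ball 0 \<rho>" "w \<notin> cball 0 h" for w
        using that h s_lower[OF that(1)] by (intro K_supp) auto
      {
        define F where "F w = indicator (ball 0 \<rho>) w * (K (norm (s w - x) / h) * q (s w))" for w
        define F0 where "F0 w = K (norm w / h) * (q x + A (\<iota> w))" for w
        have [measurable]: "F \<in> borel_measurable borel"
          unfolding F_def[abs_def] by (rule borel_measurable_comp_s) measurable
        have "continuous_on UNIV (\<lambda>w. A (\<iota> w))"
          using linear_compose[OF linear_\<iota> linA] by (simp add: o_def linear_continuous_on linear_conv_bounded_linear)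
        then have A_meas[measurable]: "(\<lambda>w. A (\<iota> w)) \<in> borel_measurable borel" by (rule borel_measurable_continuous_onI)
        have [measurable]: "F0 \<in> borel_measurable borel" unfolding F0_def[abs_def] by measurable
        have F_supp: "F w = 0" if "w \<notin> cball 0 h" for w using that Ks by (auto simp: F_def indicator_def)
        have K0_supp: "K (norm w / h) = 0" if "w \<notin> cball 0 h" for w
          using that h by (intro K_supp) auto
        have F_bdd: "\<bar>F w\<bar> \<le> L * Q" for w
        proof (cases "w \<in> cball 0 h")
          case True
          then have "w \<in> ball 0 \<rho>" "norm w \<le> h1" using h h\<rho> by auto
          then show ?thesis using K_bdd[of "norm (s w - x) / h"] q_bdd L h by (auto simp: F_def abs_mult intro!: mult_mono)
        qed (use F_supp L Q in simp)
        have diff: "\<bar>F w - F0 w\<bar> \<le> C5 * h\<^sup>2" if w: "w \<in> cball 0 h" for w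
        proof -
          have wb: "w \<in> ball 0 \<rho>" and w1: "norm w \<le> h1" and wh: "norm w \<le> h" using w h h\<rho> by auto
          let ?a = "K (norm (s w - x) / h)" and ?b = "K (norm w / h)"
          have "\<bar>?a - ?b\<bar> \<le> L * \<bar>norm (s w - x) / h - norm w / h\<bar>" using h by (intro K_lip) auto
          also have "\<bar>norm (s w - x) / h - norm w / h\<bar> = (norm (s w - x) - norm w) / h"
            using s_lower[OF wb] h by (simp add: diff_divide_distrib[symmetric])
          \<comment> \<open>The discrepancy \<open>norm (s w - x) - norm w\<close> is cubic in
            \<open>norm w\<close>, so dividing by \<open>h\<close> still leaves order
            \<open>h^2\<close>.\<close>
          also have "\<dots> \<le> C * h\<^sup>2"
          proof -
            have "norm (s w - x) - norm w \<le> C * (norm w)\<^sup>2 * norm w" using s_upper[OF wb] by (simp add: algebra_simps)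
            also have "\<dots> \<le> C * h\<^sup>2 * h" using wh C_nonneg h by (intro mult_mono power_mono) auto
            finally show ?thesis using h by (simp add: field_simps)
          qed
          finally have ab: "\<bar>?a - ?b\<bar> \<le> L * (C * h\<^sup>2)" using L by (simp add: mult_left_mono)
          have qw: "\<bar>q (s w) - (q x + A (\<iota> w))\<bar> \<le> Cq * h\<^sup>2"
            using q_taylor[OF w1] power_mono[OF wh, of 2] mult_left_mono[of "(norm w)\<^sup>2" "h\<^sup>2" Cq] Cq by auto
          have "F w - F0 w = (?a - ?b) * q (s w) + ?b * (q (s w) - (q x + A (\<iota> w)))"
            using wb by (simp add: F_def F0_def algebra_simps)
          then have "\<bar>F w - F0 w\<bar> \<le> \<bar>?a - ?b\<bar> * \<bar>q (s w)\<bar> + \<bar>?b\<bar> * \<bar>q (s w) - (q x + A (\<iota> w))\<bar>"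
            by (metis abs_mult abs_triangle_ineq)
          also have "\<dots> \<le> L * (C * h\<^sup>2) * Q + L * (Cq * h\<^sup>2)"
            using ab q_bdd[OF w1] K_bdd[of "norm w / h"] qw L h C_nonneg by (intro add_mono mult_mono) auto
          also have "\<dots> = C5 * h\<^sup>2" by (simp add: C5_def algebra_simps)
          finally show ?thesis .
        qed
        have F0_bdd: "\<bar>F0 w\<bar> \<le> L * (\<bar>q x\<bar> + NA * h)" if "w \<in> cball 0 h" for w
        proof -
          have "NA * norm w \<le> NA * h" using that NA by (intro mult_left_mono) auto
          then have "\<bar>A (\<iota> w)\<bar> \<le> NA * h" using A\<iota>[of w] by linarith
          then have "\<bar>q x + A (\<iota> w)\<bar> \<le> \<bar>q x\<bar> + NA * h" by linarith
          then show ?thesis unfolding F0_def abs_mult using K_bdd[of "norm w / h"] h L by (intro mult_mono) auto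
        qed
        have intF: "integrable lborel F" using F_supp F_bdd h by (intro lborel_integral_cball_bound[of F h "L * Q"]) auto
        have intF0: "integrable lborel F0"
          using K0_supp F0_bdd h by (intro lborel_integral_cball_bound[of F0 h "L * (\<bar>q x\<bar> + NA * h)"]) (auto simp: F0_def)
        have e1: "(\<integral>y. K (norm (y - x) / h) * q y \<partial>H) = integral\<^sup>L pullback F"
          unfolding F_def using Kz q_supp h h\<rho> by (intro integral_eq_pullback) (measurable, force)
        have e2: "\<bar>integral\<^sup>L pullback F - integral\<^sup>L lborel F\<bar> \<le> C' * h\<^sup>2 * (L * Q * (?V * h ^ DIM('b)))"
        proof -
          have "\<bar>integral\<^sup>L pullback F - integral\<^sup>L lborel F\<bar> \<le> ((1 + C * h\<^sup>2) ^ DIM('b) - 1) * (L * Q * (?V * h ^ DIM('b)))"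
            using F_supp F_bdd h h\<rho> by (intro integral_pullback_diff) auto
          also have "\<dots> \<le> C' * h\<^sup>2 * (L * Q * (?V * h ^ DIM('b)))"
          proof (rule mult_right_mono)
            have "h\<^sup>2 \<le> \<rho>\<^sup>2" using h h\<rho> by (intro power_mono) auto
            then have "(1 + C * h\<^sup>2) ^ DIM('b) - 1 \<le> real DIM('b) * (1 + C * \<rho>\<^sup>2) ^ DIM('b) * (C * h\<^sup>2)"
              using C_nonneg by (intro power_minus_one_le) (auto intro: mult_left_mono)
            then show "(1 + C * h\<^sup>2) ^ DIM('b) - 1 \<le> C' * h\<^sup>2" by (simp add: C'_def \<kappa>_def mult.assoc)
          qed (use L Q V h in auto)
          finally show ?thesis .
        qed
        have e3: "\<bar>integral\<^sup>L lborel F - integral\<^sup>L lborel F0\<bar> \<le> C5 * h\<^sup>2 * (?V * h ^ DIM('b))"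
        proof -
          have "\<bar>integral\<^sup>L lborel (\<lambda>w. F w - F0 w)\<bar> \<le> C5 * h\<^sup>2 * (?V * h ^ DIM('b))"
            using F_supp K0_supp diff h by (intro lborel_integral_cball_bound(2)) (auto simp: F0_def)
          then show ?thesis using intF intF0 by simp
        qed
        have e4: "integral\<^sup>L lborel F0 = q x * h ^ DIM('b)"
        proof -
          let ?k = "\<lambda>w::'b. K (norm w / h)" and ?o = "\<lambda>w. K (norm w / h) * A (\<iota> w)"
          have intk: "integrable lborel ?k"
            using K0_supp K_bdd h by (intro lborel_integral_cball_bound[of ?k h L]) auto
          have into: "integrable lborel ?o"
          proof (rule lborel_integral_cball_bound(1)[of ?o h "L * (NA * h)"])
            fix w :: 'b assume "w \<in> cball 0 h"
            then have "NA * norm w \<le> NA * h" using NA by (intro mult_left_mono) auto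
            then have "\<bar>A (\<iota> w)\<bar> \<le> NA * h" using A\<iota>[of w] by linarith
            then show "\<bar>?o w\<bar> \<le> L * (NA * h)"
              unfolding abs_mult using K_bdd[of "norm w / h"] h L by (intro mult_mono) auto
          qed (use K0_supp h in auto)
          have "integral\<^sup>L lborel ?k = h ^ DIM('b)"
            using lborel_integral_scaleR[of ?k h] h K_int by simp
          moreover have "integral\<^sup>L lborel ?o = 0"
          proof -
            \<comment> \<open>Reflection is scaling by \<open>-1\<close>: the radial kernel is
              unchanged, the linear factor changes sign, and the integral equals its own
              negative.\<close>
            have "integral\<^sup>L lborel ?o = (\<integral>u. ?o (- 1 *\<^sub>R u) \<partial>lborel)"
              using lborel_integral_scaleR[of ?o "-1"] by simp
            also have "\<dots> = - integral\<^sup>L lborel ?o"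
              by (simp add: linear_neg[OF linear_\<iota>] linear_neg[OF linA])
            finally show ?thesis by simp
          qed
          moreover have "integral\<^sup>L lborel F0 = q x * integral\<^sup>L lborel ?k + integral\<^sup>L lborel ?o"
            unfolding F0_def distrib_left using intk into by (simp add: mult.commute)
          ultimately show ?thesis by simp
        qed
        have "\<bar>(\<integral>y. K (norm (y - x) / h) * q y \<partial>H) - q x * h ^ DIM('b)\<bar>
          \<le> C' * h\<^sup>2 * (L * Q * (?V * h ^ DIM('b))) + C5 * h\<^sup>2 * (?V * h ^ DIM('b))"
          using e1 e2 e3 e4 by linarith
        also have "\<dots> = (C' * (L * Q) + C5) * ?V * h ^ (DIM('b) + 2)"
          by (simp add: power_add power2_eq_square algebra_simps)
        finally show "\<bar>(\<integral>y. K (norm (y - x) / h) * q y \<partial>H) - q x * h ^ DIM('b)\<bar> \<le> (C' * (L * Q) + C5) * ?V * h ^ (DIM('b) + 2)" .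
      }
      {
        define F where "F w = indicator (ball 0 \<rho>) w * ((K (norm (s w - x) / h))\<^sup>2 * q (s w))" for w
        have [measurable]: "F \<in> borel_measurable borel"
          unfolding F_def[abs_def] by (rule borel_measurable_comp_s) measurable
        have F_supp: "F w = 0" if "w \<notin> cball 0 h" for w using that Ks by (auto simp: F_def indicator_def)
        have F_nonneg: "0 \<le> F w" for w using q_nonneg by (simp add: F_def)
        have F_bdd: "F w \<le> L\<^sup>2 * Q" for w
        proof (cases "w \<in> cball 0 h")
          case True
          then have wb: "w \<in> ball 0 \<rho>" and w1: "norm w \<le> h1" using h h\<rho> by auto
          have "(K (norm (s w - x) / h))\<^sup>2 \<le> L\<^sup>2"
            using K_bdd[of "norm (s w - x) / h"] h L by (simp add: abs_le_square_iff[symmetric])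
          then show ?thesis using wb q_bdd[OF w1] q_nonneg[of "s w"] by (auto simp: F_def intro!: mult_mono)
        qed (use F_supp L Q in simp)
        have "(\<integral>y. (K (norm (y - x) / h))\<^sup>2 * q y \<partial>H) = integral\<^sup>L pullback F"
          unfolding F_def using Kz q_supp h h\<rho> by (intro integral_eq_pullback) (measurable, force)
        \<comment> \<open>For the second moment only the order of magnitude matters, so a one-sided
          comparison of measures and the supremum of the integrand suffice.\<close>
        also have "\<dots> \<le> (1 + C * h\<^sup>2) ^ DIM('b) * integral\<^sup>L lborel F"
          using F_supp F_nonneg F_bdd h h\<rho> by (intro integral_pullback_nonneg[of F h "L\<^sup>2 * Q"]) auto
        also have "\<dots> \<le> \<kappa> ^ DIM('b) * (L\<^sup>2 * Q * (?V * h ^ DIM('b)))"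
        proof (rule mult_mono)
          have "h\<^sup>2 \<le> \<rho>\<^sup>2" using h h\<rho> by (intro power_mono) auto
          then show "(1 + C * h\<^sup>2) ^ DIM('b) \<le> \<kappa> ^ DIM('b)"
            using C_nonneg by (intro power_mono) (auto simp: \<kappa>_def mult_left_mono)
          have "\<bar>integral\<^sup>L lborel F\<bar> \<le> L\<^sup>2 * Q * (?V * h ^ DIM('b))"
            using F_supp F_nonneg F_bdd h by (intro lborel_integral_cball_bound) auto
          then show "integral\<^sup>L lborel F \<le> L\<^sup>2 * Q * (?V * h ^ DIM('b))" by simp
        qed (use F_nonneg \<kappa> in \<open>auto simp: integral_nonneg\<close>)
        finally show "(\<integral>y. (K (norm (y - x) / h))\<^sup>2 * q y \<partial>H) \<le> \<kappa> ^ DIM('b) * (L\<^sup>2 * Q * ?V) * h ^ DIM('b)"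
          by (simp add: mult_ac)
      }
    qed
  qed
qed

end

section \<open>The mean square error\<close>

text \<open>Bias and variance about the common mean \<open>\<mu>\<close>: off-diagonal covariances
  vanish by independence, and each variance is at most the second moment. The bound \<open>B\<close>
  serves integrability and leaves no trace in the estimate.\<close>

lemma (in prob_space) mean_square_error_le:
  fixes Z :: "nat \<Rightarrow> 'a \<Rightarrow> real"
  assumes indep: "indep_vars (\<lambda>_. borel) Z UNIV"
    and bdd: "\<And>i \<omega>. \<bar>Z i \<omega>\<bar> \<le> B"
    and mean: "\<And>i. expectation (Z i) = \<mu>"
    and second: "\<And>i. expectation (\<lambda>\<omega>. (Z i \<omega>)\<^sup>2) \<le> V"
  shows "expectation (\<lambda>\<omega>. (a * (\<Sum>i\<in>{1..n}. Z i \<omega>) - q)\<^sup>2) \<le> a\<^sup>2 * real n * V + (a * real n * \<mu> - q)\<^sup>2"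
proof -
  have meas[measurable]: "random_variable borel (Z i)" for i
    using indep by (auto simp: indep_vars_def)
  have int: "integrable M (Z i)" for i
    using bdd by (intro integrable_const_bound[of _ B]) auto
  define W where "W i \<omega> = Z i \<omega> - \<mu>" for i \<omega>
  have [measurable]: "random_variable borel (W i)" for i by (simp add: W_def[abs_def])
  have Wbdd: "\<bar>W i \<omega>\<bar> \<le> B + \<bar>\<mu>\<bar>" for i \<omega>
    using bdd[of i \<omega>] by (simp add: W_def)
  have B0: "B \<ge> 0" using bdd[of 0 undefined] by linarith
  have WWint: "integrable M (\<lambda>\<omega>. W i \<omega> * W j \<omega>)" for i j
  proof (rule integrable_const_bound[of _ "(B + \<bar>\<mu>\<bar>) * (B + \<bar>\<mu>\<bar>)"])
    show "AE \<omega> in M. norm (W i \<omega> * W j \<omega>) \<le> (B + \<bar>\<mu>\<bar>) * (B + \<bar>\<mu>\<bar>)"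
      using Wbdd B0 by (intro AE_I2) (auto simp: abs_mult intro!: mult_mono)
  qed measurable
  have Wint: "integrable M (W i)" for i
    unfolding W_def[abs_def] by (intro Bochner_Integration.integrable_diff int) simp
  have Wmean: "expectation (W i) = 0" for i
    using int mean by (simp add: W_def[abs_def] prob_space)
  have Windep: "indep_vars (\<lambda>_. borel) W UNIV"
    unfolding W_def[abs_def] by (rule indep_vars_compose2[OF indep]) measurable
  have cross: "expectation (\<lambda>\<omega>. W i \<omega> * W j \<omega>) = 0" if "i \<noteq> j" for i j
  proof -
    have "expectation (\<lambda>\<omega>. \<Prod>k\<in>{i, j}. W k \<omega>) = (\<Prod>k\<in>{i, j}. expectation (W k))"
      by (intro indep_vars_lebesgue_integral indep_vars_subset[OF Windep] Wint) auto
    then show ?thesis using that by (simp add: Wmean)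
  qed
  have diag: "expectation (\<lambda>\<omega>. W i \<omega> * W i \<omega>) \<le> V" for i
  proof -
    have Z2: "integrable M (\<lambda>\<omega>. (Z i \<omega>)\<^sup>2)"
    proof (rule integrable_const_bound[of _ "B\<^sup>2"])
      show "AE \<omega> in M. norm ((Z i \<omega>)\<^sup>2) \<le> B\<^sup>2"
        using bdd B0 by (intro AE_I2) (auto simp: abs_le_square_iff[symmetric])
    qed measurable
    have "expectation (\<lambda>\<omega>. W i \<omega> * W i \<omega>) = expectation (\<lambda>\<omega>. (Z i \<omega>)\<^sup>2 - 2 * \<mu> * Z i \<omega> + \<mu>\<^sup>2)"
      by (intro Bochner_Integration.integral_cong) (auto simp: W_def power2_eq_square algebra_simps)
    also have "\<dots> = expectation (\<lambda>\<omega>. (Z i \<omega>)\<^sup>2) - 2 * \<mu> * \<mu> + \<mu>\<^sup>2"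
      using Z2 int mean by (simp add: prob_space)
    also have "\<dots> \<le> V" using second[of i] zero_le_square[of \<mu>] unfolding power2_eq_square by linarith
    finally show ?thesis .
  qed
  \<comment> \<open>The bias: the deviation of the estimator's mean from the target
    \<open>q\<close>.\<close>
  define \<beta> where "\<beta> = a * real n * \<mu> - q"
  have split: "(a * (\<Sum>i\<in>{1..n}. Z i \<omega>) - q)\<^sup>2 =
      a\<^sup>2 * (\<Sum>i\<in>{1..n}. \<Sum>j\<in>{1..n}. W i \<omega> * W j \<omega>) + 2 * \<beta> * a * (\<Sum>i\<in>{1..n}. W i \<omega>) + \<beta>\<^sup>2" for \<omega>
  proof -
    have "(\<Sum>i\<in>{1..n}. Z i \<omega>) = (\<Sum>i\<in>{1..n}. W i \<omega>) + real n * \<mu>"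
      by (simp add: W_def sum_subtractf)
    then have "a * (\<Sum>i\<in>{1..n}. Z i \<omega>) - q = a * (\<Sum>i\<in>{1..n}. W i \<omega>) + \<beta>"
      by (simp add: \<beta>_def algebra_simps)
    then show ?thesis by (simp add: power2_eq_square sum_product[symmetric] algebra_simps)
  qed
  have "expectation (\<lambda>\<omega>. (a * (\<Sum>i\<in>{1..n}. Z i \<omega>) - q)\<^sup>2) =
     a\<^sup>2 * (\<Sum>i\<in>{1..n}. \<Sum>j\<in>{1..n}. expectation (\<lambda>\<omega>. W i \<omega> * W j \<omega>)) + \<beta>\<^sup>2"
    unfolding split using WWint Wint by (simp add: prob_space Wmean)
  also have "(\<Sum>i\<in>{1..n}. \<Sum>j\<in>{1..n}. expectation (\<lambda>\<omega>. W i \<omega> * W j \<omega>)) =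
      (\<Sum>i\<in>{1..n}. expectation (\<lambda>\<omega>. W i \<omega> * W i \<omega>))"
  proof (rule sum.cong)
    fix i assume i: "i \<in> {1..n}"
    have "(\<Sum>j\<in>{1..n}. expectation (\<lambda>\<omega>. W i \<omega> * W j \<omega>)) = (\<Sum>j\<in>{1..n}. if j = i then expectation (\<lambda>\<omega>. W i \<omega> * W i \<omega>) else 0)"
      by (intro sum.cong) (auto simp: cross)
    then show "(\<Sum>j\<in>{1..n}. expectation (\<lambda>\<omega>. W i \<omega> * W j \<omega>)) = expectation (\<lambda>\<omega>. W i \<omega> * W i \<omega>)"
      using i by simp
  qed simp
  also have "\<dots> \<le> (\<Sum>i\<in>{1..n}. V)" by (intro sum_mono diag)
  finally show ?thesis by (simp add: \<beta>_def mult_left_mono mult.assoc)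
qed

text \<open>On the nonnegative ray through a basis vector the radial function restricts to
  \<open>K\<close>, so regularity on the ambient space passes to the one-dimensional profile, whose
  derivative is bounded on a compact interval containing the support.\<close>

lemma radial_C2_lipschitz:
  fixes K :: "real \<Rightarrow> real"
  assumes C2: "Ck_on 2 (\<lambda>u::'a::euclidean_space. K (norm u)) UNIV"
    and supp: "\<And>t. t > 1 \<Longrightarrow> K t = 0"
  obtains L where "L \<ge> 0" "\<And>a b. 0 \<le> a \<Longrightarrow> 0 \<le> b \<Longrightarrow> \<bar>K a - K b\<bar> \<le> L * \<bar>a - b\<bar>"
    and "\<And>t. t \<ge> 1 \<Longrightarrow> K t = 0"
proof -
  define k where "k u = K (norm u)" for u :: 'a
  have C2': "Ck_on 2 k UNIV" using C2 by (simp add: k_def[abs_def])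
  obtain e :: 'a where e: "e \<in> Basis" using nonempty_Basis by blast
  have ke: "k (t *\<^sub>R e) = K t" if "t \<ge> 0" for t using e that by (simp add: k_def)
  define D where "D t = partial_dir k e (t *\<^sub>R e)" for t
  have der: "((\<lambda>t. k (t *\<^sub>R e)) has_vector_derivative D t) (at t)" for t
  proof -
    have "((\<lambda>u. k (t *\<^sub>R e + u *\<^sub>R e)) has_vector_derivative D t) (at (t - t))"
      using Ck_on_partials(1)[OF C2' e, of "t *\<^sub>R e"] by (simp add: D_def)
    then have "((\<lambda>u. k (t *\<^sub>R e + (u - t) *\<^sub>R e)) has_vector_derivative 1 *\<^sub>R D t) (at t)"
      by (rule vector_diff_chain_at[unfolded o_def, rotated]) (auto intro!: derivative_eq_intros)
    then show ?thesis by (simp add: algebra_simps)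
  qed
  have "continuous_on UNIV (iter_partial [e] k)"
    by (rule Ck_on_imp_continuous_on_partial[OF C2']) (use e in auto)
  then have "continuous_on UNIV (partial_dir k e)" by simp
  from continuous_on_compose2[OF this, of "{0..2}" "\<lambda>t. t *\<^sub>R e"] have contD: "continuous_on {0..2} D"
    by (simp add: D_def[abs_def] continuous_intros)
  obtain B where B: "\<And>t. t \<in> {0..2} \<Longrightarrow> norm (D t) \<le> B"
    using compact_imp_bounded[OF compact_continuous_image[OF contD compact_Icc]] unfolding bounded_iff by blast
  define L where "L = \<bar>B\<bar>"
  have lip2: "\<bar>K a - K b\<bar> \<le> L * \<bar>a - b\<bar>" if ab: "a \<in> {0..2}" "b \<in> {0..2}" for a b
  proof -
    have "norm (k (a *\<^sub>R e) - k (b *\<^sub>R e)) \<le> L * norm (a - b)"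
    proof (rule differentiable_bound[of "{0..2}"])
      fix t :: real assume t: "t \<in> {0..2}"
      show "((\<lambda>t. k (t *\<^sub>R e)) has_derivative (\<lambda>h. h *\<^sub>R D t)) (at t within {0..2})"
        using der[of t] by (simp add: has_vector_derivative_def has_derivative_at_withinI)
      show "onorm (\<lambda>h. h *\<^sub>R D t) \<le> L"
      proof (rule onorm_le)
        fix u :: real
        have "norm (u *\<^sub>R D t) = \<bar>u\<bar> * norm (D t)" by (simp add: abs_mult)
        also have "\<dots> \<le> \<bar>u\<bar> * L" using B[OF t] by (intro mult_left_mono) (auto simp: L_def)
        finally show "norm (u *\<^sub>R D t) \<le> L * norm u" by (simp add: mult.commute)
      qed
    qed (use ab in auto)
    then show ?thesis using ab by (simp add: ke)
  qed
  have lip: "\<bar>K a - K b\<bar> \<le> L * \<bar>a - b\<bar>" if "0 \<le> a" "0 \<le> b" for a b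
  proof -
    \<comment> \<open>The interval ends at 2 because \<open>K 2 = 0\<close> is given, whereas
      \<open>K 1 = 0\<close> is known only after the Lipschitz bound.\<close>
    have clamp: "K t = K (min t 2)" for t using supp[of t] supp[of 2] by (cases "t \<le> 2") auto
    have "\<bar>K (min a 2) - K (min b 2)\<bar> \<le> L * \<bar>min a 2 - min b 2\<bar>" using that by (intro lip2) auto
    also have "\<dots> \<le> L * \<bar>a - b\<bar>" by (intro mult_left_mono) (auto simp: L_def)
    finally show ?thesis using clamp by metis
  qed
  \<comment> \<open>The support hypothesis is silent at \<open>t = 1\<close>; comparison with points
    just above 1 supplies the value.\<close>
  have "\<bar>K 1\<bar> \<le> 0"
  proof (rule field_le_epsilon)
    fix \<epsilon> :: real assume \<epsilon>: "\<epsilon> > 0"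
    have L1: "L + 1 > 0" by (simp add: L_def)
    define \<delta> where "\<delta> = \<epsilon> / (L + 1)"
    have \<delta>: "\<delta> > 0" using \<epsilon> L1 by (simp add: \<delta>_def)
    have "\<bar>K 1\<bar> \<le> L * \<delta>" using lip[of 1 "1 + \<delta>"] supp[of "1 + \<delta>"] \<delta> by simp
    also have "\<dots> \<le> (L + 1) * \<delta>" using \<delta> by (intro mult_right_mono) auto
    also have "\<dots> = \<epsilon>" using L1 by (simp add: \<delta>_def)
    finally show "\<bar>K 1\<bar> \<le> 0 + \<epsilon>" by simp
  qed
  then have "K t = 0" if "t \<ge> 1" for t using supp[of t] that by (cases "t = 1") auto
  then show thesis using lip by (intro that[of L]) (auto simp: L_def)
qed

theorem theorem1p2:
  fixes \<Omega> :: "'a::euclidean_space set"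
    and p :: "'a \<Rightarrow> real"
    and M :: "'m measure"
    and X :: "nat \<Rightarrow> 'm \<Rightarrow> 'a"
    and K :: "real \<Rightarrow> real"
    and c :: real
    and h :: "nat \<Rightarrow> real"
    and d :: nat
  assumes d_def: "d = DIM('b::euclidean_space)"
    and manifold: "AE x in hausdorff_measure d. x \<in> \<Omega> \<longrightarrow>
                     (\<exists>h0>0. smooth_submanifold TYPE('b) (ball x h0 \<inter> \<Omega>))"
    and p_nonneg: "\<forall>x\<in>\<Omega>. p x \<ge> 0"
    and p_meas: "(\<lambda>x. indicator \<Omega> x * p x) \<in> borel_measurable borel"
    and p_C2: "\<forall>x\<in>\<Omega>. (\<exists>h0>0. smooth_submanifold TYPE('b) (ball x h0 \<inter> \<Omega>)) \<longrightarrow>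
                 (\<exists>U g. x \<in> U \<and> Ck_on 2 (g :: 'a \<Rightarrow> real) U \<and> (\<forall>y\<in>U \<inter> \<Omega>. p y = g y))"
    and M: "prob_space M"
    and X_meas: "\<forall>i. X i \<in> borel_measurable M"
    and X_indep: "prob_space.indep_vars M (\<lambda>_. borel) X UNIV"
    and X_law: "\<forall>i. distr M borel (X i) =
                   density (hausdorff_measure d) (\<lambda>x. ennreal (indicator \<Omega> x * p x))"
    and K_supp: "\<forall>t\<ge>0. t > 1 \<longrightarrow> K t = 0"
    and K_int: "(\<integral>u. K (norm (u::'b)) \<partial>lborel) = 1"
    and K_C2: "Ck_on 2 (\<lambda>u::'a. K (norm u)) UNIV"
    and c_pos: "c > 0"
    and h_def: "\<forall>n. h n = c * real n powr (- 1 / (real d + 4))"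
  shows "AE x in hausdorff_measure d. x \<in> \<Omega> \<longrightarrow>
           (\<lambda>n. \<integral>\<omega>. ((1 / (real n * h n ^ d)) *
                        (\<Sum>i\<in>{1..n}. K (norm (X i \<omega> - x) / h n)) - p x) ^ 2 \<partial>M)
           \<in> O(\<lambda>n. real n powr (- 4 / (real d + 4)))"
proof (rule eventually_mono[OF manifold], intro impI)
  fix x assume "x \<in> \<Omega> \<longrightarrow> (\<exists>h0>0. smooth_submanifold TYPE('b) (ball x h0 \<inter> \<Omega>))" and x: "x \<in> \<Omega>"
  then obtain h0 where h0: "h0 > 0" "smooth_submanifold TYPE('b) (ball x h0 \<inter> \<Omega>)" by blast
  then obtain U g where g: "x \<in> U" "Ck_on 2 (g :: 'a \<Rightarrow> real) U" "\<forall>y\<in>U \<inter> \<Omega>. p y = g y"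
    using p_C2 x by blast
  interpret prob_space M by (rule M)
  define H where "H = (hausdorff_measure d :: 'a measure)"
  define q where "q y = indicator \<Omega> y * p y" for y
  have q[measurable]: "q \<in> borel_measurable borel" using p_meas by (simp add: q_def[abs_def])
  have q_nonneg: "0 \<le> q y" for y using p_nonneg by (simp add: q_def indicator_def)
  have sets_H[measurable_cong, simp]: "sets H = sets borel" by (simp add: H_def)
  have [measurable]: "X i \<in> borel_measurable M" for i using X_meas by simp
  have law: "distr M borel (X i) = density H (\<lambda>y. ennreal (q y))" for i
    using X_law by (simp add: H_def q_def[abs_def])
  \<comment> \<open>The law of \<open>X 0\<close> has mass one and a density with respect to
    \<open>H\<close>, so \<open>H\<close> cannot be the zero measure; this rules out the degenerate
    value of \<open>measure_of\<close>.\<close>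
  have H_nonzero: "emeasure H UNIV \<noteq> 0"
  proof
    assume "emeasure H UNIV = 0"
    then have "AE y in H. ennreal (q y) = 0"
      by (intro AE_I[of _ _ UNIV]) auto
    then have "emeasure (density H (\<lambda>y. ennreal (q y))) UNIV = 0"
      by (subst emeasure_density) (auto simp: nn_integral_0_iff_AE)
    moreover have "emeasure (distr M borel (X 0)) UNIV = 1"
      by (subst emeasure_distr) (auto simp: emeasure_space_1)
    ultimately show False by (simp add: law)
  qed
  obtain \<iota> :: "'b \<Rightarrow> 'a" and \<pi> s \<rho> C where "local_graph \<Omega> x \<iota> \<pi> s \<rho> C"
    using smooth_submanifold_local_graph[OF h0(1) x h0(2)] by blast
  then interpret local_graph \<Omega> x \<iota> \<pi> s \<rho> C .
  interpret hausdorff_local_graph \<Omega> x \<iota> \<pi> s \<rho> C H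
    using H_nonzero by unfold_locales (simp_all add: H_def d_def emeasure_hausdorff_measure)
  have K_supp': "K t = 0" if "t > 1" for t using K_supp that by simp
  obtain L where L: "L \<ge> 0" "\<And>a b. 0 \<le> a \<Longrightarrow> 0 \<le> b \<Longrightarrow> \<bar>K a - K b\<bar> \<le> L * \<bar>a - b\<bar>" "\<And>t. t \<ge> 1 \<Longrightarrow> K t = 0"
    by (rule radial_C2_lipschitz[OF K_C2 K_supp'], assumption) (rule that, blast+)
  have q_zero: "q y = 0" if "y \<notin> \<Omega>" for y using that by (simp add: q_def)
  have q_g: "q y = g y" if "y \<in> U \<inter> \<Omega>" for y using that g(3) by (simp add: q_def)
  obtain h1 C6 C7 where h1: "h1 > 0" and C67: "C6 \<ge> 0" "C7 \<ge> 0" and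
    bounds: "\<forall>h. 0 < h \<and> h \<le> h1 \<longrightarrow>
       \<bar>(\<integral>y. K (norm (y - x) / h) * q y \<partial>H) - q x * h ^ d\<bar> \<le> C6 * h ^ (d + 2) \<and>
       (\<integral>y. (K (norm (y - x) / h))\<^sup>2 * q y \<partial>H) \<le> C7 * h ^ d"
    by (rule kernel_moments[OF q q_zero q_nonneg g(2,1) q_g L(2,1,3) K_int, folded d_def])
  show "(\<lambda>n. \<integral>\<omega>. ((1 / (real n * h n ^ d)) * (\<Sum>i\<in>{1..n}. K (norm (X i \<omega> - x) / h n)) - p x) ^ 2 \<partial>M)
           \<in> O(\<lambda>n. real n powr (- 4 / (real d + 4)))"
  proof (rule bigoI)
    have "(\<lambda>n. c * real n powr (- 1 / (real d + 4))) \<longlonglongrightarrow> c * 0"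
      by (intro tendsto_mult tendsto_const tendsto_neg_powr filterlim_real_sequentially) (simp add: field_simps)
    then have "(\<lambda>n. h n) \<longlonglongrightarrow> 0" using h_def by simp
    then have "eventually (\<lambda>n. h n < h1) sequentially" using h1 by (rule order_tendstoD)
    then show "eventually (\<lambda>n. norm (\<integral>\<omega>. ((1 / (real n * h n ^ d)) * (\<Sum>i\<in>{1..n}. K (norm (X i \<omega> - x) / h n)) - p x) ^ 2 \<partial>M)
        \<le> (C7 / c ^ d + C6\<^sup>2 * c ^ 4) * norm (real n powr (- 4 / (real d + 4)))) sequentially"
      \<comment> \<open>At \<open>n = 0\<close> the bandwidth is \<open>0\<close>, since
        \<open>0 powr\<close> anything is \<open>0\<close>.\<close>
      using eventually_gt_at_top[of 0]
    proof eventually_elim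
      case (elim n)
      let ?h = "h n" and ?N = "real n powr (- 4 / (real d + 4))"
      have n: "real n > 0" using elim by simp
      have hpos: "?h > 0" and hle: "?h \<le> h1" using n c_pos h_def elim by auto
      have "continuous_on UNIV (\<lambda>u::'a. K (norm u))"
        using Ck_on_imp_continuous_on_partial[OF K_C2, of "[]"] by simp
      then have "continuous_on UNIV (\<lambda>y::'a. K (norm ((y - x) /\<^sub>R ?h)))"
        by (rule continuous_on_compose2) (auto intro!: continuous_intros)
      then have K_meas: "(\<lambda>y::'a. K (norm (y - x) / ?h)) \<in> borel_measurable borel"
        using hpos by (intro borel_measurable_continuous_onI) (simp add: divide_inverse mult.commute)
      have E: "expectation (\<lambda>\<omega>. f (X i \<omega>)) = (\<integral>y. f y * q y \<partial>H)" if [measurable]: "f \<in> borel_measurable borel"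
        for f :: "'a \<Rightarrow> real" and i
      proof -
        have "expectation (\<lambda>\<omega>. f (X i \<omega>)) = integral\<^sup>L (distr M borel (X i)) f"
          by (rule integral_distr[symmetric]) auto
        also have "\<dots> = (\<integral>y. q y *\<^sub>R f y \<partial>H)"
          unfolding law by (rule integral_density) (auto simp: q_nonneg)
        finally show ?thesis by (simp add: mult.commute)
      qed
      define \<mu> where "\<mu> = (\<integral>y. K (norm (y - x) / ?h) * q y \<partial>H)"
      have "(\<integral>\<omega>. ((1 / (real n * ?h ^ d)) * (\<Sum>i\<in>{1..n}. K (norm (X i \<omega> - x) / ?h)) - p x) ^ 2 \<partial>M)
         \<le> (1 / (real n * ?h ^ d))\<^sup>2 * real n * (C7 * ?h ^ d) + (1 / (real n * ?h ^ d) * real n * \<mu> - p x)\<^sup>2"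
      proof (rule mean_square_error_le[where B=L])
        show "indep_vars (\<lambda>_. borel) (\<lambda>i \<omega>. K (norm (X i \<omega> - x) / ?h)) UNIV"
          by (rule indep_vars_compose2[OF X_indep K_meas])
        show "\<bar>K (norm (X i \<omega> - x) / ?h)\<bar> \<le> L" for i \<omega>
        proof (cases "norm (X i \<omega> - x) / ?h \<le> 1")
          case True
          then show ?thesis
            using L(2)[of "norm (X i \<omega> - x) / ?h" 1] L(3)[of 1] hpos L(1)
              mult_left_mono[of "\<bar>norm (X i \<omega> - x) / ?h - 1\<bar>" 1 L] by auto
        qed (use L in auto)
        show "expectation (\<lambda>\<omega>. K (norm (X i \<omega> - x) / ?h)) = \<mu>" for i
          unfolding \<mu>_def by (rule E[OF K_meas])
        show "expectation (\<lambda>\<omega>. (K (norm (X i \<omega> - x) / ?h))\<^sup>2) \<le> C7 * ?h ^ d" for i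
          using bounds hpos hle E[of "\<lambda>y. (K (norm (y - x) / ?h))\<^sup>2" i] K_meas by simp
      qed
      \<comment> \<open>There are \<open>n\<close> summands with second moment at most
        \<open>C7 * ?h ^ d\<close>, against the squared normalisation; one power of
        \<open>n * ?h ^ d\<close> remains in the denominator.\<close>
      also have "(1 / (real n * ?h ^ d))\<^sup>2 * real n * (C7 * ?h ^ d) = C7 / (real n * ?h ^ d)"
        using n hpos by (simp add: power2_eq_square field_simps)
      also have "1 / (real n * ?h ^ d) * real n * \<mu> = \<mu> / ?h ^ d" using n by simp
      also have "(\<mu> / ?h ^ d - p x)\<^sup>2 \<le> (C6 * ?h\<^sup>2)\<^sup>2"
      proof -
        have "\<bar>\<mu> - p x * ?h ^ d\<bar> \<le> C6 * ?h ^ (d + 2)"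
          using bounds hpos hle x by (simp add: \<mu>_def q_def)
        then have "\<bar>\<mu> - p x * ?h ^ d\<bar> / ?h ^ d \<le> C6 * ?h ^ (d + 2) / ?h ^ d"
          using hpos by (intro divide_right_mono) auto
        also have "C6 * ?h ^ (d + 2) / ?h ^ d = C6 * ?h\<^sup>2" using hpos by (simp add: power_add power2_eq_square)
        also have "\<bar>\<mu> - p x * ?h ^ d\<bar> / ?h ^ d = \<bar>\<mu> / ?h ^ d - p x\<bar>"
        proof -
          have "\<mu> / ?h ^ d - p x = (\<mu> - p x * ?h ^ d) / ?h ^ d" using hpos by (simp add: diff_divide_distrib)
          then show ?thesis using hpos by (simp add: abs_divide)
        qed
        finally have "\<bar>\<mu> / ?h ^ d - p x\<bar>\<^sup>2 \<le> (C6 * ?h\<^sup>2)\<^sup>2" by (intro power_mono) auto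
        then show ?thesis by simp
      qed
      \<comment> \<open>Since \<open>1 - d / (d + 4) = 4 / (d + 4)\<close>, the product
        \<open>n * ?h ^ d\<close> is \<open>c ^ d\<close> times the reciprocal of \<open>?N\<close>,
        the same power of \<open>n\<close> that \<open>?h ^ 4\<close> produces in the bias.\<close>
      also have "C7 / (real n * ?h ^ d) = C7 / c ^ d * ?N"
      proof -
        have "?h ^ d = c ^ d * real n powr (- real d / (real d + 4))"
          using n h_def by (simp add: power_mult_distrib powr_power mult.commute)
        then have "real n * ?h ^ d = c ^ d * (real n powr 1 * real n powr (- real d / (real d + 4)))"
          using n by simp
        also have "real n powr 1 * real n powr (- real d / (real d + 4)) = real n powr (4 / (real d + 4))"
          by (simp only: powr_add[symmetric]) (simp add: field_simps)
        finally show ?thesis using n by (simp add: powr_minus_divide)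
      qed
      also have "(C6 * ?h\<^sup>2)\<^sup>2 = C6\<^sup>2 * c ^ 4 * ?N"
      proof -
        have "(C6 * ?h\<^sup>2)\<^sup>2 = C6\<^sup>2 * ?h ^ 4" by (simp add: power_mult_distrib power_mult[symmetric])
        also have "?h ^ 4 = c ^ 4 * ?N"
          using n h_def by (simp add: power_mult_distrib powr_power mult.commute)
        finally show ?thesis by simp
      qed
      finally have "(\<integral>\<omega>. ((1 / (real n * ?h ^ d)) * (\<Sum>i\<in>{1..n}. K (norm (X i \<omega> - x) / ?h)) - p x) ^ 2 \<partial>M)
         \<le> (C7 / c ^ d + C6\<^sup>2 * c ^ 4) * ?N" by (simp add: distrib_right)
      moreover have "0 \<le> (\<integral>\<omega>. ((1 / (real n * ?h ^ d)) * (\<Sum>i\<in>{1..n}. K (norm (X i \<omega> - x) / ?h)) - p x) ^ 2 \<partial>M)"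
        by (simp add: integral_nonneg)
      ultimately show ?case by simp
    qed
  qed
qed

end
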